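(* Let $n\ge 2$ and let $\hat{\mathfrak g}=\hat{\mathfrak{sl}}_n$ be the untwisted affine Lie algebra of $\mathfrak{sl}_n(\mathbb C)$, with standard Borel subalgebra $\hat{\mathfrak b}$. The number of equivalence classes of combinatorial ideals of $\hat{\mathfrak b}$ is finite and equals $$\mathbf b_n:=\mathbf C_n\cdot \omega\,\mathbf C_n .$$
   Context: **Affine algebra.** Let $\mathfrak g$ be a simple finite-dimensional complex Lie algebra with triangular decomposition $\mathfrak g=\mathfrak n_-\oplus\mathfrak h\oplus\mathfrak n_+$. The untwisted affine Lie algebra $\hat{\mathfrak g}=\mathfrak g\otimes\mathbb C[t,t^{-1}]\oplus\mathbb Cc\oplus\mathbb Cd$ is obtained from the loop algebra (bracket $[x\otimes t^k,y\otimes t^l]=[x,y]\otimes t^{k+l}$) by the universal central extension (center $\mathbb Cc$) and by adjoining the derivation $d$, $[d,x\otimes t^k]=k\,x\otimes t^k$. Put $\hat{\mathfrak h}=\mathfrak h\oplus\mathbb Cc\oplus\mathbb Cd$; $\hat{\mathfrak n}_+$ is spanned by $\mathfrak n_+\otimes 1$ and all $x\otimes t^k$ with $x\in\mathfrak g$, $k>0$; $\hat{\mathfrak b}=\hat{\mathfrak h}\oplus\hat{\mathfrak n}_+$. Here $\hat{\mathfrak g}_\alpha$ denotes the root space of a root $\alpha$ with respect to $\hat{\mathfrak h}$, and $\delta$ is the indivisible positive imaginary root (so $\hat{\mathfrak g}_{\delta}=\mathfrak h\otimes t$). **Combinatorial ideals.** An ideal $\mathfrak i$ of $\hat{\mathfrak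 b}$ is *strong* if it has finite codimension in $\hat{\mathfrak b}$ and $\mathfrak i\subset\hat{\mathfrak n}_+$; it is *thick* if for every root $\alpha$, $\mathfrak i\cap\hat{\mathfrak g}_\alpha\ne0$ implies $\hat{\mathfrak g}_\alpha\subset\mathfrak i$; it is *combinatorial* if it is strong and thick. The support $\mathrm{supp}(\mathfrak i)$ of a combinatorial ideal is the set of roots $\alpha$ with $\hat{\mathfrak g}_\alpha\subset\mathfrak i$. Combinatorial ideals $\mathfrak i,\mathfrak j$ are *equivalent* if $\mathrm{supp}(\mathfrak i)=k\delta+\mathrm{supp}(\mathfrak j)$ for some $k\in\mathbb Z$. **Matrices.** For $n\times n$ integer matrices $A=(a_{i,j})$, $B=(b_{i,j})$ put $A\cdot B=\sum_{i,j}a_{i,j}b_{i,j}$. Define linear operators $\omega,\tau$ on $n\times n$ matrices by $$(\omega A)_{i,j}=\sum_{k=n-i}^n\ \sum_{m=n-j}^n a_{k,m},\qquad (\tau A)_{i,j}=\sum_{s=i-1}^n a_{s,j},$$ with the convention $a_{0,m}=a_{k,0}=0$. Define $\mathbf C_n$ recursively by $\mathbf C_1=(1)$ and $\mathbf C_{n+1}=(\tau\,\mathbf C_n)\oplus\mathbf C_1$ (block-diagonal sum). *)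

theory Defs
  imports Complex_Main "HOL-Library.Function_Algebras" "HOL-Library.Product_Plus"
begin

section \<open>Matrices\<close>

text \<open>
  An \<open>n \<times> n\<close> matrix is a function of two indices running over \<open>{1..n}\<close>
  that vanishes at all other indices.  Sums and zero of matrices are thus the pointwise ones of
  \<^theory>\<open>HOL-Library.Function_Algebras\<close>; the pointwise product of that theory is never used.
\<close>

type_synonym 'a matrix = "nat \<Rightarrow> nat \<Rightarrow> 'a"

definition matrices :: "nat \<Rightarrow> 'a::zero matrix set" where
  "matrices n = {A. \<forall>i j. A i j \<noteq> 0 \<longrightarrow> i \<in> {1..n} \<and> j \<in> {1..n}}"

definition mmult :: "nat \<Rightarrow> complex matrix \<Rightarrow> complex matrix \<Rightarrow> complex matrix" where
  "mmult n A B = (\<lambda>i j. \<Sum>l=1..n. A i l * B l j)"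

definition trace :: "nat \<Rightarrow> complex matrix \<Rightarrow> complex" where
  "trace n A = (\<Sum>i=1..n. A i i)"

definition commutator :: "nat \<Rightarrow> complex matrix \<Rightarrow> complex matrix \<Rightarrow> complex matrix" where
  "commutator n A B = mmult n A B - mmult n B A"

definition sl :: "nat \<Rightarrow> complex matrix set" where
  "sl n = {A \<in> matrices n. trace n A = 0}"

definition sl_cartan :: "nat \<Rightarrow> complex matrix set" where
  "sl_cartan n = {A \<in> sl n. \<forall>i j. i \<noteq> j \<longrightarrow> A i j = 0}"

definition sl_nplus :: "nat \<Rightarrow> complex matrix set" where
  "sl_nplus n = {A \<in> sl n. \<forall>i j. \<not> i < j \<longrightarrow> A i j = 0}"


section \<open>The affine Lie algebra of type \<open>A\<close>\<close>

text \<open>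
  The triple \<open>(x, u, v)\<close> stands for \<open>(\<Sum>k. x k \<otimes> t\<^sup>k) + u c + v d\<close>.
  The Lie algebra is the subspace \<open>affine_sl n\<close> of this ambient complex vector space;
  the bracket is only meaningful there.
\<close>

type_synonym affine = "(int \<Rightarrow> complex matrix) \<times> complex \<times> complex"

definition scale :: "complex \<Rightarrow> affine \<Rightarrow> affine" where
  "scale a = (\<lambda>(x, u, v). (\<lambda>k i j. a * x k i j, a * u, a * v))"

global_interpretation affine: vector_space scale
proof
  fix a b :: complex and p q :: affine
  obtain x u v y u' v' where pq: "p = (x, u, v)" "q = (y, u', v')"
    by (metis prod_cases3)
  show "scale a (p + q) = scale a p + scale a q"
    by (simp add: pq scale_def plus_fun_def distrib_left)
  show "scale (a + b) p = scale a p + scale b p"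
    by (simp add: pq scale_def plus_fun_def distrib_right)
  show "scale a (scale b p) = scale (a * b) p"
    by (simp add: pq scale_def mult.assoc)
  show "scale 1 p = p"
    by (simp add: pq scale_def)
qed

definition tensor :: "complex matrix \<Rightarrow> int \<Rightarrow> affine" where
  "tensor A k = ((\<lambda>l. if l = k then A else 0), 0, 0)"

definition central :: affine where
  "central = (0, 1, 0)"

definition derivation :: affine where
  "derivation = (0, 0, 1)"

definition affine_sl :: "nat \<Rightarrow> affine set" where
  "affine_sl n = affine.span ({tensor A k | A k. A \<in> sl n} \<union> {central, derivation})"

text \<open>
  On \<open>\<ss>\<ll>\<^sub>n\<close> the normalised invariant form is the trace form, so that
  \<open>[x \<otimes> t\<^sup>k, y \<otimes> t\<^sup>l] = [x, y] \<otimes> t\<^sup>k\<^sup>+\<^sup>l + k \<delta>\<^sub>k\<^sub>,\<^sub>-\<^sub>l tr(x y) c\<close>,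
  \<open>c\<close> is central and \<open>[d, x \<otimes> t\<^sup>k] = k x \<otimes> t\<^sup>k\<close>.
  The sums below are finite since \<open>x\<close> has finite support.
\<close>

definition bracket :: "nat \<Rightarrow> affine \<Rightarrow> affine \<Rightarrow> affine" where
  "bracket n = (\<lambda>(x, u, v) (y, u', v').
     (\<lambda>m i j. (\<Sum>k | x k \<noteq> 0. commutator n (x k) (y (m - k)) i j)
                + v * of_int m * y m i j - v' * of_int m * x m i j,
      \<Sum>k | x k \<noteq> 0. of_int k * trace n (mmult n (x k) (y (- k))),
      0))"

definition cartan :: "nat \<Rightarrow> affine set" where
  "cartan n = affine.span ({tensor A 0 | A. A \<in> sl_cartan n} \<union> {central, derivation})"

definition nplus :: "nat \<Rightarrow> affine set" where
  "nplus n = affine.span ({tensor A 0 | A. A \<in> sl_nplus n} \<union> {tensor A k | A k. A \<in> sl n \<and> 0 < k})"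

definition borel :: "nat \<Rightarrow> affine set" where
  "borel n = {h + e | h e. h \<in> cartan n \<and> e \<in> nplus n}"


section \<open>Roots\<close>

text \<open>
  A linear functional on the Cartan subalgebra is extended by \<open>0\<close> outside of it, so that
  functionals are equal iff they agree on the Cartan subalgebra, and are added pointwise.
\<close>

definition dual :: "nat \<Rightarrow> (affine \<Rightarrow> complex) set" where
  "dual n = {\<alpha>. (\<forall>g\<in>cartan n. \<forall>h\<in>cartan n. \<alpha> (g + h) = \<alpha> g + \<alpha> h) \<and>
                (\<forall>a. \<forall>h\<in>cartan n. \<alpha> (scale a h) = a * \<alpha> h) \<and>
                (\<forall>x. x \<notin> cartan n \<longrightarrow> \<alpha> x = 0)}"

definition root_space :: "nat \<Rightarrow> (affine \<Rightarrow> complex) \<Rightarrow> affine set" where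
  "root_space n \<alpha> = {x \<in> affine_sl n. \<forall>h\<in>cartan n. bracket n h x = scale (\<alpha> h) x}"

definition roots :: "nat \<Rightarrow> (affine \<Rightarrow> complex) set" where
  "roots n = {\<alpha> \<in> dual n. \<alpha> \<noteq> 0 \<and> root_space n \<alpha> \<noteq> {0}}"

text \<open>
  The root \<open>\<delta>\<close>, whose root space is \<open>\<hh> \<otimes> t\<close>, takes the value \<open>1\<close> at \<open>d\<close> and
  vanishes on \<open>\<hh> \<otimes> 1\<close> and on \<open>c\<close>.
\<close>

definition delta :: "nat \<Rightarrow> affine \<Rightarrow> complex" where
  "delta n = (\<lambda>h. if h \<in> cartan n then snd (snd h) else 0)"


section \<open>Combinatorial ideals of the Borel subalgebra\<close>

definition borel_ideal :: "nat \<Rightarrow> affine set \<Rightarrow> bool" where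
  "borel_ideal n I \<longleftrightarrow>
     I \<subseteq> borel n \<and> affine.subspace I \<and> (\<forall>x\<in>borel n. \<forall>y\<in>I. bracket n x y \<in> I)"

definition finite_codim :: "nat \<Rightarrow> affine set \<Rightarrow> bool" where
  "finite_codim n I \<longleftrightarrow> (\<exists>F. finite F \<and> F \<subseteq> borel n \<and> borel n \<subseteq> affine.span (I \<union> F))"

definition strong :: "nat \<Rightarrow> affine set \<Rightarrow> bool" where
  "strong n I \<longleftrightarrow> finite_codim n I \<and> I \<subseteq> nplus n"

definition thick :: "nat \<Rightarrow> affine set \<Rightarrow> bool" where
  "thick n I \<longleftrightarrow> (\<forall>\<alpha>\<in>roots n. I \<inter> root_space n \<alpha> \<noteq> {0} \<longrightarrow> root_space n \<alpha> \<subseteq> I)"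

definition combinatorial_ideals :: "nat \<Rightarrow> affine set set" where
  "combinatorial_ideals n = {I. borel_ideal n I \<and> strong n I \<and> thick n I}"

definition supp :: "nat \<Rightarrow> affine set \<Rightarrow> (affine \<Rightarrow> complex) set" where
  "supp n I = {\<alpha> \<in> roots n. root_space n \<alpha> \<subseteq> I}"

definition ideal_equiv :: "nat \<Rightarrow> (affine set \<times> affine set) set" where
  "ideal_equiv n = {(I, J). I \<in> combinatorial_ideals n \<and> J \<in> combinatorial_ideals n \<and>
     (\<exists>k::int. supp n I = (\<lambda>\<alpha> h. of_int k * delta n h + \<alpha> h) ` supp n J)}"

lemma equiv_ideal_equiv: "equiv (combinatorial_ideals n) (ideal_equiv n)"
proof (rule equivI)
  let ?S = "\<lambda>k::int. (\<lambda>\<alpha> h. of_int k * delta n h + \<alpha> h)"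
  have add: "?S k ` ?S l ` X = ?S (k + l) ` X" for k l X
    by (auto simp: image_image algebra_simps)
  show "ideal_equiv n \<subseteq> combinatorial_ideals n \<times> combinatorial_ideals n"
    by (auto simp: ideal_equiv_def)
  show "refl_on (combinatorial_ideals n) (ideal_equiv n)"
  proof (rule refl_onI)
    fix I assume "I \<in> combinatorial_ideals n"
    moreover have "supp n I = ?S 0 ` supp n I"
      by simp
    ultimately show "(I, I) \<in> ideal_equiv n"
      unfolding ideal_equiv_def by blast
  qed
  show "sym (ideal_equiv n)"
  proof (rule symI)
    fix I J assume "(I, J) \<in> ideal_equiv n"
    then obtain k where k: "supp n I = ?S k ` supp n J"
      and IJ: "I \<in> combinatorial_ideals n" "J \<in> combinatorial_ideals n"
      unfolding ideal_equiv_def by blast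
    have "?S (- k) ` supp n I = supp n J"
      unfolding k add by simp
    with IJ show "(J, I) \<in> ideal_equiv n"
      unfolding ideal_equiv_def by blast
  qed
  show "trans (ideal_equiv n)"
  proof (rule transI)
    fix I J K assume "(I, J) \<in> ideal_equiv n" "(J, K) \<in> ideal_equiv n"
    then obtain k l where "supp n I = ?S k ` supp n J" "supp n J = ?S l ` supp n K"
      and IK: "I \<in> combinatorial_ideals n" "K \<in> combinatorial_ideals n"
      unfolding ideal_equiv_def by blast
    then have "supp n I = ?S (k + l) ` supp n K"
      by (simp only: add)
    with IK show "(I, K) \<in> ideal_equiv n"
      unfolding ideal_equiv_def by blast
  qed
qed


section \<open>The numbers \<open>b\<^sub>n\<close>\<close>

text \<open>
  As matrices vanish outside \<open>{1..n} \<times> {1..n}\<close>, the terms with an index \<open>0\<close> in the sums below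
  contribute nothing.
\<close>

definition mdot :: "nat \<Rightarrow> int matrix \<Rightarrow> int matrix \<Rightarrow> int" where
  "mdot n A B = (\<Sum>i=1..n. \<Sum>j=1..n. A i j * B i j)"

definition omega :: "nat \<Rightarrow> int matrix \<Rightarrow> int matrix" where
  "omega n A = (\<lambda>i j. if i \<in> {1..n} \<and> j \<in> {1..n} then \<Sum>k=n-i..n. \<Sum>m=n-j..n. A k m else 0)"

definition tau :: "nat \<Rightarrow> int matrix \<Rightarrow> int matrix" where
  "tau n A = (\<lambda>i j. if i \<in> {1..n} \<and> j \<in> {1..n} then \<Sum>s=i-1..n. A s j else 0)"

definition one_matrix :: "int matrix" where
  "one_matrix = (\<lambda>i j. if i = 1 \<and> j = 1 then 1 else 0)"

text \<open>The block sum of an \<open>n \<times> n\<close> matrix \<open>A\<close> with a matrix \<open>B\<close> of any size.\<close>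

definition block_sum :: "nat \<Rightarrow> int matrix \<Rightarrow> int matrix \<Rightarrow> int matrix" where
  "block_sum n A B = (\<lambda>i j. if i \<le> n \<and> j \<le> n then A i j
                            else if n < i \<and> n < j then B (i - n) (j - n) else 0)"

text \<open>The sequence starts at \<open>n = 1\<close>; the value at \<open>0\<close> is a dummy.\<close>

fun C_matrix :: "nat \<Rightarrow> int matrix" where
  "C_matrix 0 = 0"
| "C_matrix (Suc 0) = one_matrix"
| "C_matrix (Suc (Suc n)) = block_sum (Suc n) (tau (Suc n) (C_matrix (Suc n))) one_matrix"

definition b_number :: "nat \<Rightarrow> int" where
  "b_number n = mdot n (C_matrix n) (omega n (C_matrix n))"

end

theory Submission
  imports Defs "HOL-Library.FuncSet"
begin

text \<open>
  A thick ideal inside \<open>nplus n\<close> is stable under the Cartan subalgebra, hence a sum of root spaces.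
  Writing the root \<open>\<epsilon>\<^sub>i - \<epsilon>\<^sub>j + k \<delta>\<close> as the pair \<open>(i, j + k n)\<close>, with \<open>i = j\<close> for the imaginary root
  \<open>k \<delta>\<close>, the ideal is given by thresholds on the second component, and up to a shift by a
  multiple of \<open>\<delta>\<close> these thresholds form a monotone sequence \<open>g 1, \<dots>, g n\<close> with
  \<open>i < g i \<le> i + n\<close> and \<open>g n \<le> g 1 + n\<close>.  Cutting the values of \<open>g\<close> at \<open>n + 1\<close> turns it into a pair
  of Dyck-like staircases \<open>u\<close>, \<open>w\<close> which are independent up to two conditions: one on their first
  values and one on how often they take the maximal value \<open>n + 1\<close>.  The matrix \<open>C_matrix n\<close> counts
  staircases by these two statistics, the recursion coming from the removal of the first entry,
  and \<open>omega\<close> encodes the two conditions.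
\<close>

text \<open>Root spaces become accessible through one Cartan element,
  \<open>separator n \<i>\<close>, on which distinct roots take distinct values: a polynomial in its
  adjoint action cuts a single weight out of an element of the ideal, and thickness then supplies
  the whole root space. The obstacle is the imaginary roots, whose root spaces have dimension n - 1
  and consist of traceless diagonal matrices. Matrices can therefore not be split entry by entry,
  and predicates on positions must agree on all diagonal positions of one degree. The same fact
  yields the shift: whether k \<delta> belongs to the ideal does not depend on the row i, so the
  thresholds of all rows lie in windows of length n with a common offset, whence i < g i \<le> i +
  n. Monotonicity and g n \<le> g 1 + n come from bracketing with E(i',i), i' < i, and with E(n,1)
  \<otimes> t. In terms of the staircases, the condition on first values is g n \<le> g 1 + n again,
  and the one on maximal values says that at every position at least one of the two parts is
  maximal.\<close>

lemma sum_fun_apply: "(\<Sum>i\<in>A. f i) x = (\<Sum>i\<in>A. f i x)"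
  by (induction A rule: infinite_finite_induct) auto

lemma scale_simp [simp]: "scale a (x, u, v) = (\<lambda>k i j. a * x k i j, a * u, a * v)"
  by (simp add: scale_def)

section \<open>Explicit descriptions of the subalgebras\<close>

text \<open>One shape for the loop parts of \<open>nplus\<close>, \<open>cartan\<close>,
  \<open>borel\<close>, the root spaces and the ideals: only the predicate \<open>P\<close> on
  positions varies, so many inclusions reduce to \<open>loop_mono\<close>.\<close>

definition loop :: "nat \<Rightarrow> (nat \<Rightarrow> nat \<Rightarrow> int \<Rightarrow> bool) \<Rightarrow> (int \<Rightarrow> complex matrix) set" where
  "loop n P = {x. finite {k. x k \<noteq> 0} \<and> (\<forall>k. x k \<in> sl n) \<and> (\<forall>i j k. x k i j \<noteq> 0 \<longrightarrow> P i j k)}"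

lemma loopI:
  assumes "finite {k. x k \<noteq> 0}" "\<And>k. x k \<in> sl n" "\<And>i j k. x k i j \<noteq> 0 \<Longrightarrow> P i j k"
  shows "x \<in> loop n P"
  using assms by (auto simp: loop_def)

lemma loop_range: "x \<in> loop n P \<Longrightarrow> x k i j \<noteq> 0 \<Longrightarrow> i \<in> {1..n} \<and> j \<in> {1..n}"
  unfolding loop_def sl_def matrices_def by blast

lemma loop_mono:
  assumes x: "x \<in> loop n P"
    and PQ: "\<And>i j k. i \<in> {1..n} \<Longrightarrow> j \<in> {1..n} \<Longrightarrow> P i j k \<Longrightarrow> Q i j k"
  shows "x \<in> loop n Q"
proof (rule loopI)
  show "Q i j k" if "x k i j \<noteq> 0" for i j k
    using x that PQ[of i j k] loop_range[OF x that] by (simp add: loop_def)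
qed (use x in \<open>auto simp: loop_def\<close>)

lemma loop_cong:
  assumes "\<And>i j k. i \<in> {1..n} \<Longrightarrow> j \<in> {1..n} \<Longrightarrow> P i j k = Q i j k"
  shows "loop n P = loop n Q"
  using assms loop_mono[of _ n P Q] loop_mono[of _ n Q P] by (intro antisym subsetI) simp_all

lemma sl_0 [simp]: "0 \<in> sl n"
  by (simp add: sl_def matrices_def trace_def)

lemma sl_add: "A \<in> sl n \<Longrightarrow> B \<in> sl n \<Longrightarrow> A + B \<in> sl n"
  by (auto simp: sl_def matrices_def trace_def sum.distrib) (metis add.right_neutral)+

lemma sl_scale: "A \<in> sl n \<Longrightarrow> (\<lambda>i j. a * A i j) \<in> sl n"
  by (auto simp: sl_def matrices_def trace_def simp flip: sum_distrib_left)

lemma loop_0: "0 \<in> loop n P"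
  by (simp add: loop_def)

lemma loop_add: "x \<in> loop n P \<Longrightarrow> y \<in> loop n P \<Longrightarrow> x + y \<in> loop n P"
proof (rule loopI)
  assume *: "x \<in> loop n P" "y \<in> loop n P"
  have "{k. (x + y) k \<noteq> 0} \<subseteq> {k. x k \<noteq> 0} \<union> {k. y k \<noteq> 0}"
    by auto
  then show "finite {k. (x + y) k \<noteq> 0}"
    using * by (auto simp: loop_def dest: finite_subset)
  show "(x + y) k \<in> sl n" for k
    using * by (auto simp: loop_def sl_add)
  show "P i j k" if "(x + y) k i j \<noteq> 0" for i j k
  proof -
    have "x k i j \<noteq> 0 \<or> y k i j \<noteq> 0"
      using that by auto
    then show ?thesis using * by (auto simp: loop_def)
  qed
qed

lemma loop_scale: "x \<in> loop n P \<Longrightarrow> (\<lambda>k i j. a * x k i j) \<in> loop n P"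
proof (rule loopI)
  assume *: "x \<in> loop n P"
  have "{k. (\<lambda>i j. a * x k i j) \<noteq> 0} \<subseteq> {k. x k \<noteq> 0}"
    by (auto simp: fun_eq_iff)
  then show "finite {k. (\<lambda>i j. a * x k i j) \<noteq> 0}"
    using * by (auto simp: loop_def dest: finite_subset)
qed (auto simp: loop_def sl_scale)

lemma subspace_loop: "affine.subspace {(x, 0, 0) | x. x \<in> loop n P}"
  unfolding affine.subspace_def
proof (intro conjI ballI allI)
  show "0 \<in> {(x, 0, 0) |x. x \<in> loop n P}"
    using loop_0 by (auto simp: zero_prod_def)
qed (auto intro: loop_add loop_scale)

lemma tensor_sum:
  assumes "finite K" "{k. x k \<noteq> 0} \<subseteq> K"
  shows "(x, 0, 0) = (\<Sum>k\<in>K. tensor (x k) k)"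
proof -
  have *: "x l = (\<Sum>k\<in>K. if l = k then x k else 0)" for l
    using assms by (cases "l \<in> K") (auto simp: sum.delta')
  then show ?thesis
    by (simp add: tensor_def sum_prod fun_eq_iff sum_fun_apply)
qed

lemma tensor_in_loop:
  "A \<in> sl n \<Longrightarrow> (\<And>i j. A i j \<noteq> 0 \<Longrightarrow> P i j k) \<Longrightarrow> \<exists>x. tensor A k = (x, 0, 0) \<and> x \<in> loop n P"
proof -
  assume *: "A \<in> sl n" "\<And>i j. A i j \<noteq> 0 \<Longrightarrow> P i j k"
  have "finite {l. (if l = k then A else 0) \<noteq> 0}"
    by (rule finite_subset[of _ "{k}"]) auto
  then have "(\<lambda>l. if l = k then A else 0) \<in> loop n P"
    using * by (auto simp: loop_def split: if_splits)
  then show ?thesis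
    by (auto simp: tensor_def)
qed

lemma span_loop:
  assumes "\<And>p. p \<in> S \<Longrightarrow> \<exists>A k. p = tensor A k \<and> A \<in> sl n \<and> (\<forall>i j. A i j \<noteq> 0 \<longrightarrow> P i j k)"
    and "\<And>A k. A \<in> sl n \<Longrightarrow> A \<noteq> 0 \<Longrightarrow> (\<And>i j. A i j \<noteq> 0 \<Longrightarrow> P i j k) \<Longrightarrow> tensor A k \<in> S"
  shows "affine.span S = {(x, 0, 0) | x. x \<in> loop n P}"
proof (rule antisym)
  show "affine.span S \<subseteq> {(x, 0, 0) | x. x \<in> loop n P}"
  proof (rule affine.span_minimal[OF _ subspace_loop], rule subsetI)
    fix p assume "p \<in> S"
    then obtain A k where "p = tensor A k" "A \<in> sl n" "\<forall>i j. A i j \<noteq> 0 \<longrightarrow> P i j k"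
      using assms(1) by blast
    then show "p \<in> {(x, 0, 0) | x. x \<in> loop n P}"
      using tensor_in_loop[of A n P k] by auto
  qed
  show "{(x, 0, 0) | x. x \<in> loop n P} \<subseteq> affine.span S"
  proof clarify
    fix x assume x: "x \<in> loop n P"
    then have "(x, 0, 0) = (\<Sum>k\<in>{k. x k \<noteq> 0}. tensor (x k) k)"
      by (intro tensor_sum) (auto simp: loop_def)
    also have "\<dots> \<in> affine.span S"
      by (rule affine.span_sum, rule affine.span_base, rule assms(2)) (use x in \<open>auto simp: loop_def\<close>)
    finally show "(x, 0, 0) \<in> affine.span S" .
  qed
qed

lemma span_central_derivation:
  assumes "affine.span S = {(x, 0, 0) | x. x \<in> X}"
  shows "affine.span (S \<union> {central, derivation}) = {(x, u, v) | x u v. x \<in> X}"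
proof -
  have *: "affine.span {central, derivation} = {(0, u, v) | u v. True}"
    by (auto simp: affine.span_insert central_def derivation_def fun_eq_iff zero_fun_def zero_prod_def minus_prod_def)
  show ?thesis
    unfolding affine.span_Un assms * by auto
qed

definition positive :: "nat \<Rightarrow> nat \<Rightarrow> int \<Rightarrow> bool" where
  "positive i j k \<longleftrightarrow> 0 < k \<or> k = 0 \<and> i < j"

lemma nplus_eq: "nplus n = {(x, 0, 0) | x. x \<in> loop n positive}"
  unfolding nplus_def
  by (rule span_loop) (auto simp: sl_nplus_def positive_def fun_eq_iff, blast+)

lemma affine_sl_eq: "affine_sl n = {(x, u, v) | x u v. x \<in> loop n (\<lambda>_ _ _. True)}"
  unfolding affine_sl_def
  by (rule span_central_derivation, rule span_loop) auto

lemma cartan_eq: "cartan n = {(x, u, v) | x u v. x \<in> loop n (\<lambda>i j k. i = j \<and> k = 0)}"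
  unfolding cartan_def
proof (rule span_central_derivation, rule span_loop)
  fix A k assume A: "A \<in> sl n" "A \<noteq> 0" "\<And>i j. A i j \<noteq> 0 \<Longrightarrow> i = j \<and> k = (0::int)"
  then have "k = 0"
    by (auto simp: fun_eq_iff)
  then show "tensor A k \<in> {tensor A 0 |A. A \<in> sl_cartan n}"
    using A by (auto simp: sl_cartan_def)
qed (auto simp: sl_cartan_def)

text \<open>The trace is the only condition that couples entries, and it couples just the diagonal
  of one degree. Since \<open>Q\<close> keeps or drops such a diagonal as a whole, the truncated
  matrix stays traceless.\<close>

lemma loop_restrict:
  assumes x: "x \<in> loop n P" and Q: "\<And>i j k. Q i i k = Q j j k"
  shows "(\<lambda>k i j. if Q i j k then x k i j else 0) \<in> loop n (\<lambda>i j k. P i j k \<and> Q i j k)"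
proof (rule loopI)
  let ?y = "\<lambda>k i j. if Q i j k then x k i j else 0"
  show "finite {k. ?y k \<noteq> 0}"
    by (rule finite_subset[of _ "{k. x k \<noteq> 0}"]) (use x in \<open>auto simp: loop_def fun_eq_iff\<close>)
  fix k
  \<comment> \<open>As \<open>Q\<close> is constant along the diagonal, any index represents it; 0
    serves as a fixed one.\<close>
  have "trace n (?y k) = (if Q 0 0 k then trace n (x k) else 0)"
  proof -
    have "?y k i i = (if Q 0 0 k then x k i i else 0)" for i
      using Q[of i k 0] by simp
    then show ?thesis
      by (simp add: trace_def del: if_split_asm)
  qed
  then show "?y k \<in> sl n"
    using x by (auto simp: loop_def sl_def matrices_def)
qed (use x in \<open>auto simp: loop_def split: if_splits\<close>)

lemma borel_eq: "borel n = {(x, u, v) | x u v. x \<in> loop n (\<lambda>i j k. positive i j k \<or> i = j \<and> k = 0)}"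
proof (intro antisym subsetI)
  fix p assume "p \<in> borel n"
  then show "p \<in> {(x, u, v) | x u v. x \<in> loop n (\<lambda>i j k. positive i j k \<or> i = j \<and> k = 0)}"
    by (auto simp: borel_def cartan_eq nplus_eq elim!: loop_mono intro!: loop_add)
next
  fix p :: affine assume "p \<in> {(x, u, v) | x u v. x \<in> loop n (\<lambda>i j k. positive i j k \<or> i = j \<and> k = 0)}"
  then obtain x u v where p: "p = (x, u, v)"
    and x: "x \<in> loop n (\<lambda>i j k. positive i j k \<or> i = j \<and> k = 0)"
    by blast
  let ?h = "\<lambda>k i j. if i = j \<and> k = 0 then x k i j else 0"
  let ?e = "\<lambda>k i j. if \<not> (i = j \<and> k = 0) then x k i j else 0"
  have "(?h, u, v) \<in> cartan n"
    unfolding cartan_eq by (auto intro: loop_mono[OF loop_restrict[OF x]])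
  moreover have "(?e, 0, 0) \<in> nplus n"
    unfolding nplus_eq by (auto intro: loop_mono[OF loop_restrict[OF x]])
  moreover have "p = (?h, u, v) + (?e, 0, 0)"
    by (auto simp: p fun_eq_iff)
  ultimately show "p \<in> borel n"
    unfolding borel_def by blast
qed

section \<open>Roots and root spaces\<close>

definition root_fun :: "nat \<Rightarrow> nat \<Rightarrow> nat \<Rightarrow> int \<Rightarrow> affine \<Rightarrow> complex" where
  "root_fun n i j k = (\<lambda>h. if h \<in> cartan n then fst h 0 i i - fst h 0 j j + of_int k * snd (snd h) else 0)"

lemma root_diag: "root_fun n i i k = root_fun n j j k"
  by (simp add: root_fun_def fun_eq_iff)

lemma subspace_cartan: "affine.subspace (cartan n)"
  unfolding cartan_def by (rule affine.subspace_span)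

lemma root_in_dual: "root_fun n i j k \<in> dual n"
proof -
  have "g + h \<in> cartan n" "scale a g \<in> cartan n" if "g \<in> cartan n" "h \<in> cartan n" for g h a
    using that subspace_cartan affine.subspace_add affine.subspace_scale by blast+
  moreover have "fst (scale a h) 0 i i = a * fst h 0 i i" "snd (snd (scale a h)) = a * snd (snd h)" for a h i
    by (simp_all add: scale_def split: prod.split)
  ultimately show ?thesis
    by (auto simp: dual_def root_fun_def algebra_simps)
qed

text \<open>
  The diagonal matrix with entries \<open>2\<^sup>i\<close>, corrected to have trace \<open>0\<close>; differences of powers of
  two determine the exponents.
\<close>

definition separator :: "nat \<Rightarrow> complex \<Rightarrow> affine" where
  "separator n v = (\<lambda>k i j. if k = 0 \<and> i = j \<and> i \<in> {1..n}
     then 2 ^ i - (\<Sum>l=1..n. 2 ^ l) / of_nat n else 0, 0, v)"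

lemma separator_cartan:
  assumes "n \<ge> 1"
  shows "separator n v \<in> cartan n"
proof -
  let ?t = "\<lambda>k i j. if k = (0::int) \<and> i = j \<and> i \<in> {1..n}
     then 2 ^ i - (\<Sum>l=1..n. 2 ^ l) / of_nat n else (0::complex)"
  have "?t \<in> loop n (\<lambda>i j k. i = j \<and> k = 0)"
  proof (rule loopI)
    show "finite {k. ?t k \<noteq> 0}"
      by (rule finite_subset[of _ "{0}"]) (auto simp: fun_eq_iff)
    show "?t k \<in> sl n" for k
      using assms by (cases "k = 0") (auto simp: sl_def matrices_def trace_def sum_subtractf)
  qed (auto split: if_splits)
  then show ?thesis
    by (simp add: separator_def cartan_eq)
qed

lemma root_separator:
  assumes "n \<ge> 1" "i \<in> {1..n}" "j \<in> {1..n}"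
  shows "root_fun n i j k (separator n v) = 2 ^ i - 2 ^ j + of_int k * v"
  using assms separator_cartan[of n v] by (simp add: root_fun_def) (simp add: separator_def)

text \<open>For b < a the difference is \<open>2 ^ b\<close> times an odd number, so its 2-adic
  valuation is b and then a is determined as well. The second alternative is the difference
  0.\<close>

lemma power_diff_eq:
  assumes "(2::int) ^ a - 2 ^ b = 2 ^ i - 2 ^ j"
  shows "a = i \<and> b = j \<or> a = b \<and> i = j"
proof -
  have *: "a = i \<and> b = j" if "(2::int) ^ a - 2 ^ b = 2 ^ i - 2 ^ j" "b < a" for a b i j :: nat
  proof -
    have "(2::int) ^ b < 2 ^ a"
      using that by simp
    then have "(2::int) ^ j < 2 ^ i"
      using that(1) by linarith
    then have "j < i"
      by simp
    have eq: "(2::int) ^ b * (2 ^ (a - b) - 1) = 2 ^ j * (2 ^ (i - j) - 1)"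
      using that \<open>j < i\<close> by (simp add: algebra_simps flip: power_add)
    have odd: "odd ((2::int) ^ (a - b) - 1)" "odd ((2::int) ^ (i - j) - 1)"
      using \<open>b < a\<close> \<open>j < i\<close> by simp_all
    have "\<not> b < j" if "(2::int) ^ b * x = 2 ^ j * y" "odd x" for b j x y
    proof
      assume "b < j"
      then have "(2::int) ^ b * x = 2 ^ b * (2 ^ (j - b) * y)"
        using that by (simp add: mult.assoc[symmetric] flip: power_add)
      then show False
        using that(2) \<open>b < j\<close> by simp
    qed
    from this[OF eq odd(1)] this[OF eq[symmetric] odd(2)] have "b = j"
      by simp
    then show ?thesis
      using that by simp
  qed
  consider "b < a" | "a < b" | "a = b"
    by linarith
  then show ?thesis
  proof cases
    case 2
    then show ?thesis
      using *[of b a j i] assms by simp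
  qed (use *[of a b i j] assms in auto)
qed

text \<open>With \<i> as value of the d-coordinate, the real part of the root value is
  \<open>2 ^ i - 2 ^ j\<close> and the imaginary part is k. So a single Cartan element tells all
  roots apart; the remaining ambiguity is that all diagonal positions of one degree carry the same
  root.\<close>

lemma root_separator_eqD:
  assumes "n \<ge> 1" "i \<in> {1..n}" "j \<in> {1..n}" "a \<in> {1..n}" "b \<in> {1..n}"
    and "root_fun n i j k (separator n \<i>) = root_fun n a b m (separator n \<i>)"
  shows "k = m \<and> (i = a \<and> j = b \<or> i = j \<and> a = b)"
proof -
  have eq: "(2::complex) ^ i - 2 ^ j + of_int k * \<i> = 2 ^ a - 2 ^ b + of_int m * \<i>"
    using assms by (simp add: root_separator)
  have re: "Re ((2::complex) ^ l) = 2 ^ l \<and> Im ((2::complex) ^ l) = 0" for l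
    by (induction l) auto
  have "(2::real) ^ i - 2 ^ j = 2 ^ a - 2 ^ b"
    using arg_cong[OF eq, of Re] by (simp add: re)
  then have "real_of_int (2 ^ i - 2 ^ j) = real_of_int (2 ^ a - 2 ^ b)"
    by simp
  then have "(2::int) ^ i - 2 ^ j = 2 ^ a - 2 ^ b"
    by (simp only: of_int_eq_iff)
  moreover have "k = m"
    using arg_cong[OF eq, of Im] by (simp add: re)
  ultimately show ?thesis
    using power_diff_eq by blast
qed

lemma root_eq_iff:
  assumes "n \<ge> 1" "i \<in> {1..n}" "j \<in> {1..n}" "a \<in> {1..n}" "b \<in> {1..n}"
  shows "root_fun n i j k = root_fun n a b m \<longleftrightarrow> k = m \<and> (i = a \<and> j = b \<or> i = j \<and> a = b)"
proof
  assume "root_fun n i j k = root_fun n a b m"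
  then show "k = m \<and> (i = a \<and> j = b \<or> i = j \<and> a = b)"
    by (intro root_separator_eqD[OF assms]) simp
next
  assume "k = m \<and> (i = a \<and> j = b \<or> i = j \<and> a = b)"
  then show "root_fun n i j k = root_fun n a b m"
    by (auto intro: root_diag)
qed

lemma root_eq_0_iff:
  assumes "n \<ge> 1" "i \<in> {1..n}" "j \<in> {1..n}"
  shows "root_fun n i j k = 0 \<longleftrightarrow> i = j \<and> k = 0"
proof -
  have "root_fun n i i 0 = 0"
    by (simp add: root_fun_def fun_eq_iff)
  then show ?thesis
    using root_eq_iff[OF assms assms(2) assms(2), of k 0] by auto
qed

text \<open>The loop part of h is diagonal of degree 0, so its commutator rescales each entry, and d
  contributes the degree. The cocycle carries the degree of h as a factor and vanishes; for the same
  reason the d-component of the second argument has no effect.\<close>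

lemma bracket_cartan:
  assumes h: "h \<in> cartan n" and x: "x \<in> loop n P"
  shows "bracket n h (x, u, v) = (\<lambda>m a b. root_fun n a b m h * x m a b, 0, 0)"
proof -
  obtain t c d where h_eq: "h = (t, c, d)" and t: "t \<in> loop n (\<lambda>i j k. i = j \<and> k = 0)"
    using h by (auto simp: cartan_eq)
  have t0: "t k = 0" if "k \<noteq> 0" for k
    using t that by (auto simp: loop_def fun_eq_iff)
  have td: "t 0 i j = 0" if "i \<noteq> j" for i j
    using t that by (auto simp: loop_def)
  have sub: "{k. t k \<noteq> 0} \<subseteq> {0}"
    using t0 by auto
  have s1: "(\<Sum>k | t k \<noteq> 0. commutator n (t k) (x (m - k)) a b) = commutator n (t 0) (x m) a b" for m a b
  proof -
    have "(\<Sum>k | t k \<noteq> 0. commutator n (t k) (x (m - k)) a b) = (\<Sum>k\<in>{0}. commutator n (t k) (x (m - k)) a b)"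
      by (rule sum.mono_neutral_left) (use sub in \<open>auto simp: commutator_def mmult_def\<close>)
    then show ?thesis by simp
  qed
  have s2: "(\<Sum>k | t k \<noteq> 0. of_int k * trace n (mmult n (t k) (x (- k)))) = 0"
    by (rule sum.neutral) (use t0 in auto)
  have s3: "commutator n (t 0) (x m) a b = (t 0 a a - t 0 b b) * x m a b" for m a b
  proof (cases "a \<in> {1..n} \<and> b \<in> {1..n}")
    case True
    have "(\<Sum>l=1..n. t 0 a l * x m l b) = (\<Sum>l=1..n. if l = a then t 0 a a * x m a b else 0)"
      by (rule sum.cong) (auto simp: td)
    moreover have "(\<Sum>l=1..n. x m a l * t 0 l b) = (\<Sum>l=1..n. if l = b then x m a b * t 0 b b else 0)"
      by (rule sum.cong) (auto simp: td)
    ultimately show ?thesis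
      using True by (simp add: commutator_def mmult_def algebra_simps)
  next
    case False
    then have "x m a b = 0" and *: "t 0 a l * x m l b = 0" "x m a l * t 0 l b = 0" for l
      using loop_range[OF x, of m] loop_range[OF t, of 0] by (metis mult_eq_0_iff)+
    then show ?thesis
      by (simp add: commutator_def mmult_def *)
  qed
  have s4: "v * of_int m * t m a b = 0" for m a b
    using t0[of m] by (cases "m = 0") auto
  have "(t 0 a a - t 0 b b) * x m a b + d * of_int m * x m a b = root_fun n a b m h * x m a b" for m a b
    using h by (simp add: h_eq root_fun_def algebra_simps)
  then show ?thesis
    unfolding h_eq bracket_def by (simp only: prod.case s1 s2 s3 s4 diff_zero)
qed

lemma dual_outside: "\<alpha> \<in> dual n \<Longrightarrow> h \<notin> cartan n \<Longrightarrow> \<alpha> h = 0"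
  unfolding dual_def by blast

lemma root_space_eq:
  assumes "\<alpha> \<in> dual n" "\<alpha> \<noteq> 0"
  shows "root_space n \<alpha> = {(x, 0, 0) | x. x \<in> loop n (\<lambda>i j k. root_fun n i j k = \<alpha>)}"
proof (intro antisym subsetI)
  fix p assume p: "p \<in> root_space n \<alpha>"
  then obtain x u v where p_eq: "p = (x, u, v)" and x: "x \<in> loop n (\<lambda>_ _ _. True)"
    by (auto simp: root_space_def affine_sl_eq)
  have eq: "(\<lambda>m a b. root_fun n a b m h * x m a b, 0, 0) = scale (\<alpha> h) (x, u, v)" if "h \<in> cartan n" for h
    unfolding bracket_cartan[OF that x, of u v, symmetric] using p that unfolding root_space_def p_eq by blast
  \<comment> \<open>A bracket with h has no c- or d-component, so a nonzero eigenvalue forces those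
    of an eigenvector to vanish.\<close>
  obtain h where h: "\<alpha> h \<noteq> 0"
    using assms(2) by (auto simp: fun_eq_iff)
  then have "h \<in> cartan n"
    using dual_outside[OF assms(1)] by blast
  from eq[OF this] h have uv: "u = 0" "v = 0"
    by auto
  have "root_fun n a b m = \<alpha>" if "x m a b \<noteq> 0" for a b m
  proof
    fix h
    show "root_fun n a b m h = \<alpha> h"
    proof (cases "h \<in> cartan n")
      case True
      then show ?thesis
        using eq[OF True] that by (auto simp: fun_eq_iff)
    next
      case False
      then show ?thesis
        using dual_outside[OF assms(1)] by (simp add: root_fun_def)
    qed
  qed
  then show "p \<in> {(x, 0, 0) | x. x \<in> loop n (\<lambda>i j k. root_fun n i j k = \<alpha>)}"
    using x uv p_eq by (auto simp: loop_def)
next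
  fix p assume "p \<in> {(x, 0::complex, 0::complex) | x. x \<in> loop n (\<lambda>i j k. root_fun n i j k = \<alpha>)}"
  then obtain x where p: "p = (x, 0, 0)" and x: "x \<in> loop n (\<lambda>i j k. root_fun n i j k = \<alpha>)"
    by blast
  have "bracket n h p = scale (\<alpha> h) p" if "h \<in> cartan n" for h
  proof -
    have *: "root_fun n a b m h * x m a b = \<alpha> h * x m a b" for m a b
      using x by (cases "x m a b = 0") (auto simp: loop_def)
    then show ?thesis
      unfolding p bracket_cartan[OF that x] by (simp only: * scale_simp mult_zero_right)
  qed
  moreover have "p \<in> affine_sl n"
    using loop_mono[OF x] by (auto simp: p affine_sl_eq)
  ultimately show "p \<in> root_space n \<alpha>"
    by (simp add: root_space_def)
qed

lemma root_space_root:
  assumes "n \<ge> 1" "i \<in> {1..n}" "j \<in> {1..n}" "i \<noteq> j \<or> k \<noteq> 0"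
  shows "root_space n (root_fun n i j k) = {(x, 0, 0) | x. x \<in> loop n (\<lambda>a b m. root_fun n a b m = root_fun n i j k)}"
  using assms root_eq_0_iff by (intro root_space_eq root_in_dual) auto

lemma exists_other:
  assumes "n \<ge> (2::nat)"
  shows "\<exists>l\<in>{1..n}. l \<noteq> i"
proof (cases "i = 1")
  case True
  then show ?thesis
    using assms by (intro bexI[of _ 2]) auto
next
  case False
  then show ?thesis
    using assms by (intro bexI[of _ 1]) auto
qed

section \<open>Matrix units and root vectors\<close>

definition matrix_unit :: "nat \<Rightarrow> nat \<Rightarrow> complex matrix" where
  "matrix_unit i j = (\<lambda>a b. if a = i \<and> b = j then 1 else 0)"

lemma matrix_unit_sl: "i \<in> {1..n} \<Longrightarrow> j \<in> {1..n} \<Longrightarrow> i \<noteq> j \<Longrightarrow> matrix_unit i j \<in> sl n"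
  by (auto simp: sl_def matrices_def trace_def matrix_unit_def intro!: sum.neutral)

lemma matrix_unit_diff_sl:
  assumes "i \<in> {1..n}" "j \<in> {1..n}"
  shows "matrix_unit i i - matrix_unit j j \<in> sl n"
  using assms by (auto simp: sl_def matrices_def trace_def matrix_unit_def sum_subtractf)

text \<open>
  A vector in the space of the root with indices \<open>i\<close>, \<open>j\<close>; the auxiliary index \<open>l\<close>
  only matters for the imaginary roots \<open>i = j\<close>.
\<close>

definition root_vector :: "nat \<Rightarrow> nat \<Rightarrow> nat \<Rightarrow> complex matrix" where
  "root_vector l i j = (if i = j then matrix_unit i i - matrix_unit l l else matrix_unit i j)"

lemma root_vector_sl:
  "i \<in> {1..n} \<Longrightarrow> j \<in> {1..n} \<Longrightarrow> l \<in> {1..n} \<Longrightarrow> root_vector l i j \<in> sl n"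
  by (auto simp: root_vector_def intro: matrix_unit_sl matrix_unit_diff_sl)

lemma root_vector_nonzero: "l \<noteq> i \<Longrightarrow> root_vector l i j i j \<noteq> 0"
  by (auto simp: root_vector_def matrix_unit_def)

lemma root_vector_root_space:
  assumes "i \<in> {1..n}" "j \<in> {1..n}" "l \<in> {1..n}" "i \<noteq> j \<or> k \<noteq> 0"
  shows "tensor (root_vector l i j) k \<in> root_space n (root_fun n i j k)"
proof -
  have "root_fun n a b k = root_fun n i j k" if "root_vector l i j a b \<noteq> 0" for a b
    using that root_diag by (auto simp: root_vector_def matrix_unit_def split: if_splits)
  then show ?thesis
    using tensor_in_loop[OF root_vector_sl[OF assms(1-3)], of "\<lambda>a b m. root_fun n a b m = root_fun n i j k" k] assms
    by (subst root_space_root) auto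
qed

text \<open>For the imaginary roots the nonzero root vector is E(i,i) - E(l,l) with l \<noteq> i,
  which is where n \<ge> 2 enters.\<close>

lemma roots_iff:
  assumes "n \<ge> 2"
  shows "\<alpha> \<in> roots n \<longleftrightarrow> (\<exists>i\<in>{1..n}. \<exists>j\<in>{1..n}. \<exists>k. (i \<noteq> j \<or> k \<noteq> 0) \<and> \<alpha> = root_fun n i j k)"
proof
  assume \<alpha>: "\<alpha> \<in> roots n"
  then have sp: "root_space n \<alpha> = {(x, 0, 0) | x. x \<in> loop n (\<lambda>i j k. root_fun n i j k = \<alpha>)}"
    using root_space_eq by (auto simp: roots_def)
  have "0 \<in> root_space n \<alpha>"
    unfolding sp zero_prod_def using loop_0 by blast
  then obtain p where "p \<in> root_space n \<alpha>" "p \<noteq> 0"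
    using \<alpha> by (auto simp: roots_def)
  then obtain x where x: "x \<in> loop n (\<lambda>i j k. root_fun n i j k = \<alpha>)" "x \<noteq> 0"
    unfolding sp by (auto simp: zero_prod_def)
  then obtain i j k where "x k i j \<noteq> 0"
    by (auto simp: fun_eq_iff)
  then have "i \<in> {1..n}" "j \<in> {1..n}" "\<alpha> = root_fun n i j k"
    using x(1) loop_range[OF x(1)] by (auto simp: loop_def)
  moreover have "i \<noteq> j \<or> k \<noteq> 0"
    using \<alpha> root_eq_0_iff[of n i j k] calculation assms by (auto simp: roots_def)
  ultimately show "\<exists>i\<in>{1..n}. \<exists>j\<in>{1..n}. \<exists>k. (i \<noteq> j \<or> k \<noteq> 0) \<and> \<alpha> = root_fun n i j k"
    by blast
next
  assume "\<exists>i\<in>{1..n}. \<exists>j\<in>{1..n}. \<exists>k. (i \<noteq> j \<or> k \<noteq> 0) \<and> \<alpha> = root_fun n i j k"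
  then obtain i j k where ij: "i \<in> {1..n}" "j \<in> {1..n}" "i \<noteq> j \<or> k \<noteq> 0" and \<alpha>: "\<alpha> = root_fun n i j k"
    by blast
  obtain l where l: "l \<in> {1..n}" "l \<noteq> i"
    using exists_other[OF assms] by blast
  have "tensor (root_vector l i j) k \<in> root_space n \<alpha>"
    unfolding \<alpha> using ij l by (intro root_vector_root_space)
  moreover have "tensor (root_vector l i j) k \<noteq> 0"
    using root_vector_nonzero[OF l(2), of j] by (auto simp: tensor_def zero_prod_def fun_eq_iff)
  moreover have "\<alpha> \<noteq> 0"
    using ij assms root_eq_0_iff by (auto simp: \<alpha>)
  ultimately show "\<alpha> \<in> roots n"
    using root_in_dual by (auto simp: roots_def \<alpha>)
qed

section \<open>Combinatorial ideals are sums of root spaces\<close>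

text \<open>The cocycle term occurs only for k + l = 0 and carries the factor k, so the hypothesis
  removes it.\<close>

lemma bracket_tensor:
  assumes "k + l \<noteq> 0 \<or> k = 0"
  shows "bracket n (tensor A k) (tensor B l) = tensor (commutator n A B) (k + l)"
proof (cases "A = 0")
  case True
  have "commutator n 0 B = 0"
    by (simp add: commutator_def mmult_def fun_eq_iff)
  then show ?thesis
    by (simp add: bracket_def tensor_def True fun_eq_iff)
next
  case False
  have "{l. (if l = k then A else 0) \<noteq> 0} = {k}"
    using False by auto
  moreover have "commutator n A 0 = 0" "trace n (mmult n A 0) = 0"
    by (simp_all add: commutator_def mmult_def trace_def fun_eq_iff)
  ultimately show ?thesis
    using assms by (auto simp: bracket_def tensor_def fun_eq_iff)
qed

lemma mmult_unit_left: "b \<in> {1..n} \<Longrightarrow> mmult n (matrix_unit a b) B i c = (if i = a then B b c else 0)"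
  by (simp add: mmult_def matrix_unit_def if_distrib[of "\<lambda>x. x * _"] cong: if_cong)

lemma mmult_unit_right: "a \<in> {1..n} \<Longrightarrow> mmult n B (matrix_unit a b) c d = (if d = b then B c a else 0)"
  by (simp add: mmult_def matrix_unit_def if_distrib[of "\<lambda>x. _ * x"] cong: if_cong)

lemma matrix_unit_eq_0_iff: "matrix_unit i j a b = 0 \<longleftrightarrow> \<not> (a = i \<and> b = j)"
  by (simp add: matrix_unit_def)

lemma tensor_borel: "A \<in> sl n \<Longrightarrow> (\<And>i j. A i j \<noteq> 0 \<Longrightarrow> positive i j k) \<Longrightarrow> tensor A k \<in> borel n"
  using tensor_in_loop[of A n "\<lambda>i j k. positive i j k \<or> i = j \<and> k = 0" k] by (auto simp: borel_eq)

lemma finite_support: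
  assumes "x \<in> loop n P"
  shows "finite {(k, i, j). x k i j \<noteq> 0}"
proof (rule finite_subset)
  show "{(k, i, j). x k i j \<noteq> 0} \<subseteq> {k. x k \<noteq> 0} \<times> {1..n} \<times> {1..n}"
    using loop_range[OF assms] by (fastforce simp: fun_eq_iff)
  show "finite ({k. x k \<noteq> 0} \<times> {1..n} \<times> {1..n})"
    using assms by (auto simp: loop_def)
qed

locale combinatorial_ideal =
  fixes n :: nat and I :: "affine set"
  assumes n2: "n \<ge> 2" and I: "I \<in> combinatorial_ideals n"
begin

definition mem :: "nat \<Rightarrow> nat \<Rightarrow> int \<Rightarrow> bool" where
  "mem i j k \<longleftrightarrow> positive i j k \<and> root_space n (root_fun n i j k) \<subseteq> I"

lemma subspace_I: "affine.subspace I"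
  using I by (simp add: combinatorial_ideals_def borel_ideal_def)

lemma bracket_I: "p \<in> borel n \<Longrightarrow> q \<in> I \<Longrightarrow> bracket n p q \<in> I"
  using I by (simp add: combinatorial_ideals_def borel_ideal_def)

lemma I_nplus: "p \<in> I \<Longrightarrow> \<exists>x. p = (x, 0, 0) \<and> x \<in> loop n positive"
  using I by (auto simp: combinatorial_ideals_def strong_def nplus_eq)

lemma I_loop: "(x, u, v) \<in> I \<Longrightarrow> x \<in> loop n positive"
  using I_nplus by blast

lemma thick_I: "\<alpha> \<in> roots n \<Longrightarrow> I \<inter> root_space n \<alpha> \<noteq> {0} \<Longrightarrow> root_space n \<alpha> \<subseteq> I"
  using I by (auto simp: combinatorial_ideals_def thick_def)

text \<open>An ideal is stable under ad h - \<mu>, which multiplies each entry by its root value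
  minus \<mu>. Composing over \<open>M\<close> annihilates all weights with values in
  \<open>M\<close>.\<close>

lemma weight_filter:
  assumes "(x, 0, 0) \<in> I" "h \<in> cartan n" "finite M"
  shows "(\<lambda>k i j. (\<Prod>\<mu>\<in>M. root_fun n i j k h - \<mu>) * x k i j, 0, 0) \<in> I"
  using assms(3)
proof induction
  case empty
  then show ?case
    using assms(1) by simp
next
  case (insert \<mu> M)
  let ?y = "\<lambda>k i j. (\<Prod>\<mu>\<in>M. root_fun n i j k h - \<mu>) * x k i j"
  have h: "h \<in> borel n"
    using assms(2) by (auto simp: cartan_eq borel_eq elim: loop_mono)
  have "bracket n h (?y, 0, 0) - scale \<mu> (?y, 0, 0) \<in> I"
    using insert.IH subspace_I bracket_I[OF h] affine.subspace_diff affine.subspace_scale by blast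
  moreover have "bracket n h (?y, 0, 0) - scale \<mu> (?y, 0, 0)
      = (\<lambda>k i j. (\<Prod>\<mu>\<in>insert \<mu> M. root_fun n i j k h - \<mu>) * x k i j, 0, 0)"
    unfolding bracket_cartan[OF assms(2) I_loop[OF insert.IH]]
    using insert.hyps by (simp add: fun_diff_def zero_prod_def algebra_simps)
  ultimately show ?case
    by simp
qed

text \<open>A nonzero entry of an element of the ideal can be isolated up to its root: the filter
  removes all other weights, what remains is a nonzero element of the root space inside the ideal,
  and thickness gives the rest.\<close>

lemma mem_entry:
  assumes x: "(x, 0, 0) \<in> I" and nz: "x k i j \<noteq> 0"
  shows "mem i j k"
proof -
  have ij: "i \<in> {1..n}" "j \<in> {1..n}" and n1: "n \<ge> 1"
    using loop_range[OF I_loop[OF x] nz] n2 by auto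
  have pos: "positive i j k"
    using I_loop[OF x] nz by (auto simp: loop_def)
  then have nonzero: "i \<noteq> j \<or> k \<noteq> 0"
    by (auto simp: positive_def)
  let ?h = "separator n \<i>"
  let ?ev = "\<lambda>i j k. root_fun n i j k ?h"
  have h: "?h \<in> cartan n"
    using n1 by (rule separator_cartan)
  \<comment> \<open>The values of the separator on all weights of x except the one to be kept; the
    factor left at (i, j, k) is therefore nonzero.\<close>
  define M where "M = (\<lambda>(k, i, j). ?ev i j k) ` {(k, i, j). x k i j \<noteq> 0} - {?ev i j k}"
  have M: "finite M"
    unfolding M_def using finite_support[OF I_loop[OF x]] by blast
  define y where "y = (\<lambda>k i j. (\<Prod>\<mu>\<in>M. ?ev i j k - \<mu>) * x k i j)"
  have y: "(y, 0, 0) \<in> I"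
    unfolding y_def by (rule weight_filter[OF x h M])
  have "root_fun n a b m = root_fun n i j k" if "y m a b \<noteq> 0" for a b m
  proof -
    have xnz: "x m a b \<noteq> 0" and "?ev a b m \<notin> M"
      using that M by (auto simp: y_def)
    then have "?ev a b m = ?ev i j k"
      by (force simp: M_def)
    moreover have "a \<in> {1..n}" "b \<in> {1..n}"
      using loop_range[OF I_loop[OF x] xnz] by auto
    ultimately show ?thesis
      using root_separator_eqD[OF n1 _ _ ij] root_eq_iff[OF n1 _ _ ij] by blast
  qed
  then have "(y, 0, 0) \<in> root_space n (root_fun n i j k)"
    unfolding root_space_root[OF n1 ij nonzero] using I_loop[OF y] by (auto simp: loop_def)
  moreover have "y k i j \<noteq> 0"
    using nz M by (auto simp: y_def M_def)
  then have "(y, 0, 0) \<noteq> (0 :: affine)"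
    by (auto simp: zero_prod_def)
  ultimately have "I \<inter> root_space n (root_fun n i j k) \<noteq> {0}"
    using y by blast
  moreover have "root_fun n i j k \<in> roots n"
    using ij nonzero roots_iff[OF n2] by blast
  ultimately have "root_space n (root_fun n i j k) \<subseteq> I"
    using thick_I by blast
  then show ?thesis
    using pos by (simp add: mem_def)
qed

text \<open>From here on the ideal is replaced by the combinatorial predicate
  \<open>mem\<close>.\<close>

lemma I_eq: "I = {(x, 0, 0) | x. x \<in> loop n mem}"
proof (intro antisym subsetI)
  fix p assume "p \<in> I"
  then obtain x where "p = (x, 0, 0)" "x \<in> loop n positive" "(x, 0, 0) \<in> I"
    using I_nplus by blast
  then show "p \<in> {(x, 0, 0) | x. x \<in> loop n mem}"
    using mem_entry by (auto simp: loop_def)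
next
  fix p :: affine assume "p \<in> {(x, 0, 0) | x. x \<in> loop n mem}"
  then obtain x where p: "p = (x, 0, 0)" and x: "x \<in> loop n mem"
    by blast
  \<comment> \<open>The sum runs over roots and not over positions, because a single diagonal entry
    is not traceless, whereas the whole diagonal of one degree is.\<close>
  define F where "F = (\<lambda>(k, i, j). root_fun n i j k) ` {(k, i, j). x k i j \<noteq> 0}"
  define c where "c = (\<lambda>\<alpha> k i j. if root_fun n i j k = \<alpha> then x k i j else 0)"
  have F: "finite F"
    unfolding F_def using finite_support[OF x] by blast
  have "x k i j = (\<Sum>\<alpha>\<in>F. c \<alpha> k i j)" for k i j
  proof (cases "x k i j = 0")
    case True
    then have "c \<alpha> k i j = 0" for \<alpha>
      by (simp add: c_def)
    then show ?thesis
      using True by simp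
  next
    case False
    then have "root_fun n i j k \<in> F"
      by (force simp: F_def)
    then show ?thesis
      using F by (simp add: c_def)
  qed
  then have "p = (\<Sum>\<alpha>\<in>F. (c \<alpha>, 0, 0))"
    by (simp add: p sum_prod fun_eq_iff sum_fun_apply)
  moreover have "(c \<alpha>, 0, 0) \<in> I" if "\<alpha> \<in> F" for \<alpha>
  proof -
    obtain i j k where nz: "x k i j \<noteq> 0" and \<alpha>: "\<alpha> = root_fun n i j k"
      using \<open>\<alpha> \<in> F\<close> by (auto simp: F_def)
    then have "mem i j k"
      using x by (auto simp: loop_def)
    then have nonzero: "i \<noteq> j \<or> k \<noteq> 0" and sub: "root_space n \<alpha> \<subseteq> I"
      by (auto simp: mem_def positive_def \<alpha>)
    have "c \<alpha> \<in> loop n (\<lambda>a b m. mem a b m \<and> root_fun n a b m = \<alpha>)"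
      unfolding c_def by (rule loop_restrict[OF x], rule arg_cong[of _ _ "\<lambda>r. r = \<alpha>"], rule root_diag)
    then have "c \<alpha> \<in> loop n (\<lambda>a b m. root_fun n a b m = \<alpha>)"
      by (rule loop_mono) simp
    moreover have "i \<in> {1..n}" "j \<in> {1..n}" "n \<ge> 1"
      using loop_range[OF x nz] n2 by auto
    ultimately show ?thesis
      using sub root_space_root[of n i j k] nonzero unfolding \<alpha> by auto
  qed
  ultimately show "p \<in> I"
    by (simp only: affine.subspace_sum[OF subspace_I])
qed

section \<open>Closure of the positions of an ideal under brackets\<close>

lemma mem_positive: "mem i j k \<Longrightarrow> positive i j k"
  by (simp add: mem_def)

lemma mem_diag: "mem i i k = mem j j k"
  by (simp add: mem_def root_diag[of n i k j] positive_def)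

lemma mem_root_vector:
  assumes "i \<in> {1..n}" "j \<in> {1..n}" "l \<in> {1..n}" "mem i j k"
  shows "tensor (root_vector l i j) k \<in> I"
  using assms root_vector_root_space[OF assms(1-3), of k] by (auto simp: mem_def positive_def)

text \<open>Bracketing a root vector of the ideal with a homogeneous element of the Borel subalgebra
  stays in the ideal, and \<open>mem_entry\<close> applies to every nonzero entry of the result.
  Since k \<ge> 0 by positivity, m \<ge> 0 rules out the cocycle term.\<close>

lemma mem_commutator:
  assumes A: "A \<in> sl n" "\<And>i j. A i j \<noteq> 0 \<Longrightarrow> positive i j m" "m \<ge> 0"
    and B: "i \<in> {1..n}" "j \<in> {1..n}" "l \<in> {1..n}" "mem i j k"
    and nz: "commutator n A (root_vector l i j) a b \<noteq> 0"
  shows "mem a b (m + k)"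
proof -
  have "m + k \<noteq> 0 \<or> m = 0"
    using A(3) mem_positive[OF B(4)] by (auto simp: positive_def)
  then have "bracket n (tensor A m) (tensor (root_vector l i j) k) = tensor (commutator n A (root_vector l i j)) (m + k)"
    by (rule bracket_tensor)
  moreover have "bracket n (tensor A m) (tensor (root_vector l i j) k) \<in> I"
    using A B by (intro bracket_I tensor_borel mem_root_vector) auto
  ultimately show ?thesis
    using nz by (intro mem_entry[of "\<lambda>r. if r = m + k then commutator n A (root_vector l i j) else 0"])
      (auto simp: tensor_def)
qed

text \<open>The commutator of E(j,l) with the root vector has entry -1 at (i,l) if i \<noteq> j. If
  i = j, using the target l as auxiliary index makes the vector E(j,j) - E(l,l) and the entry -2. So
  the imaginary roots are covered, as source by the case i = j and as target by the case l =
  i.\<close>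

lemma mem_right:
  assumes "i \<in> {1..n}" "j \<in> {1..n}" "l \<in> {1..n}" "mem i j k" "positive j l m" "l \<noteq> j"
  shows "mem i l (m + k)"
proof -
  have "commutator n (matrix_unit j l) (root_vector l i j) i l \<noteq> 0"
    using assms by (simp add: commutator_def mmult_unit_left mmult_unit_right)
      (auto simp: root_vector_def matrix_unit_def)
  then show ?thesis
    using assms by (intro mem_commutator[of "matrix_unit j l" m i j l k i l])
      (auto simp: matrix_unit_eq_0_iff positive_def intro!: matrix_unit_sl)
qed

lemma mem_left:
  assumes "i \<in> {1..n}" "j \<in> {1..n}" "l \<in> {1..n}" "mem i j k" "positive l i m" "l \<noteq> i"
  shows "mem l j (m + k)"
proof -
  have "commutator n (matrix_unit l i) (root_vector l i j) l j \<noteq> 0"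
    using assms by (simp add: commutator_def mmult_unit_left mmult_unit_right)
      (auto simp: root_vector_def matrix_unit_def)
  then show ?thesis
    using assms by (intro mem_commutator[of "matrix_unit l i" m i j l k l j])
      (auto simp: matrix_unit_eq_0_iff positive_def intro!: matrix_unit_sl)
qed

text \<open>If row i had no position in the ideal, the entry at (i,j) would vanish on the ideal in
  every degree. In a degree k beyond all degrees of a finite complement it would vanish on the span
  of both, yet E(i,j) \<otimes> t^k lies in the Borel subalgebra.\<close>

lemma mem_exists:
  assumes i: "i \<in> {1..n}"
  shows "\<exists>j\<in>{1..n}. \<exists>k. mem i j k"
proof (rule ccontr)
  assume *: "\<not> (\<exists>j\<in>{1..n}. \<exists>k. mem i j k)"
  obtain j where j: "j \<in> {1..n}" "j \<noteq> i"
    using exists_other[OF n2] by blast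
  obtain F where F: "finite F" "F \<subseteq> borel n" "borel n \<subseteq> affine.span (I \<union> F)"
    using I by (auto simp: combinatorial_ideals_def strong_def finite_codim_def)
  define K where "K = (\<Union>p\<in>F. {k. fst p k \<noteq> 0})"
  have "finite K"
    unfolding K_def using F by (auto simp: borel_eq loop_def)
  then have "finite (insert 0 K)"
    by simp
  then obtain k where k: "k > Max (insert 0 K)"
    using gt_ex by blast
  then have "k \<notin> K" "k > 0"
    using \<open>finite K\<close> by auto
  let ?V = "{p :: affine. fst p k i j = 0}"
  have "affine.subspace ?V"
    by (auto simp: affine.subspace_def scale_def split: prod.split)
  moreover have "I \<union> F \<subseteq> ?V"
  proof
    fix p assume "p \<in> I \<union> F"
    then show "p \<in> ?V"
    proof
      assume "p \<in> I"
      then obtain x where p: "p = (x, 0, 0)" and x: "(x, 0, 0) \<in> I"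
        using I_nplus by blast
      show "p \<in> ?V"
        using mem_entry[OF x, of k i j] * j by (auto simp: p)
    next
      assume "p \<in> F"
      then have "fst p k = 0"
        using \<open>k \<notin> K\<close> by (auto simp: K_def)
      then show "p \<in> ?V"
        by simp
    qed
  qed
  ultimately have "borel n \<subseteq> ?V"
    using F(3) affine.span_minimal by blast
  moreover have "tensor (matrix_unit i j) k \<in> borel n"
    using i j \<open>k > 0\<close> by (intro tensor_borel matrix_unit_sl) (auto simp: positive_def)
  ultimately show False
    by (auto simp: tensor_def matrix_unit_def)
qed

end

section \<open>Profiles\<close>

text \<open>
  Identify the root with indices \<open>i\<close>, \<open>j\<close>, \<open>k\<close> with the pair \<open>(i, j + k n)\<close>.  Then
  a combinatorial ideal consists, for each \<open>i\<close>, of the pairs \<open>(i, q)\<close> with \<open>q\<close> above a threshold.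
  A profile is such a sequence of thresholds, shifted so that the least imaginary root in the
  ideal is \<open>\<delta>\<close>.
\<close>

definition profiles :: "nat \<Rightarrow> (nat \<Rightarrow> nat) set" where
  "profiles n = {g \<in> extensional {1..n}. (\<forall>i\<in>{1..n}. i < g i \<and> g i \<le> i + n) \<and>
     mono_on {1..n} g \<and> g n \<le> g 1 + n}"

lemma profilesD:
  assumes "g \<in> profiles n"
  shows "i \<in> {1..n} \<Longrightarrow> i < g i" "i \<in> {1..n} \<Longrightarrow> g i \<le> i + n"
    "i \<in> {1..n} \<Longrightarrow> j \<in> {1..n} \<Longrightarrow> i \<le> j \<Longrightarrow> g i \<le> g j" "g n \<le> g 1 + n"
  using assms by (simp_all add: profiles_def mono_on_def)

definition above :: "nat \<Rightarrow> (nat \<Rightarrow> nat) \<Rightarrow> nat \<Rightarrow> nat \<Rightarrow> nat \<Rightarrow> int \<Rightarrow> bool" where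
  "above n g m i j k \<longleftrightarrow> i \<in> {1..n} \<and> j \<in> {1..n} \<and> int (g i) + int m * int n \<le> int j + k * int n"

definition profile_ideal :: "nat \<Rightarrow> (nat \<Rightarrow> nat) \<Rightarrow> nat \<Rightarrow> affine set" where
  "profile_ideal n g m = {(x, 0, 0) | x. x \<in> loop n (above n g m)}"

lemma residue_unique:
  assumes "j \<in> {1..n}" "j' \<in> {1..n}" "int j + k * int n = int j' + k' * int n"
  shows "j = j' \<and> k = k'"
proof -
  \<comment> \<open>Residues run over \<open>{1..n}\<close>, so 1 is subtracted before
    dividing.\<close>
  have 1: "(int j - 1 + k * int n) div int n = k" "(int j' - 1 + k' * int n) div int n = k'"
    using assms(1,2) by (simp_all add: div_pos_pos_trivial)
  have "k = k'"
    using assms(3) 1 by (metis add_diff_eq diff_add_eq)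
  then show ?thesis
    using assms(3) by simp
qed

lemma residue_exists:
  assumes "n \<ge> 1"
  shows "\<exists>j\<in>{1..n}. \<exists>k. q = int j + k * int n"
proof (intro bexI exI)
  have "0 \<le> (q - 1) mod int n" "(q - 1) mod int n < int n"
    using assms by auto
  then show "nat ((q - 1) mod int n) + 1 \<in> {1..n}"
    by auto
  show "q = int (nat ((q - 1) mod int n) + 1) + ((q - 1) div int n) * int n"
    using assms by simp
qed

context combinatorial_ideal
begin

definition mem_index :: "nat \<Rightarrow> int \<Rightarrow> bool" where
  "mem_index i q \<longleftrightarrow> (\<exists>j\<in>{1..n}. \<exists>k. q = int j + k * int n \<and> mem i j k)"

lemma mem_index_iff: "j \<in> {1..n} \<Longrightarrow> mem_index i (int j + k * int n) \<longleftrightarrow> mem i j k"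
  unfolding mem_index_def using residue_unique by metis

lemma mem_index_greater: "i \<in> {1..n} \<Longrightarrow> mem_index i q \<Longrightarrow> int i < q"
proof -
  assume i: "i \<in> {1..n}" and "mem_index i q"
  then obtain j k where j: "j \<in> {1..n}" and q: "q = int j + k * int n" and "positive i j k"
    using mem_positive by (auto simp: mem_index_def)
  then consider "k \<ge> 1" | "k = 0" "i < j"
    by (force simp: positive_def)
  then show "int i < q"
  proof cases
    case 1
    then have "int n \<le> k * int n"
      using mult_right_mono[of 1 k "int n"] by simp
    then show ?thesis
      using i j unfolding q by (simp only: atLeastAtMost_iff) linarith
  qed (use q in simp)
qed

text \<open>Raising q by one is bracketing with a simple root vector: E(j,j+1) for j < n, and E(n,1)
  \<otimes> t at the wrap j = n.\<close>

lemma mem_index_Suc: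
  assumes i: "i \<in> {1..n}" and "mem_index i q"
  shows "mem_index i (q + 1)"
proof -
  obtain j k where j: "j \<in> {1..n}" and q: "q = int j + k * int n" and m: "mem i j k"
    using assms by (auto simp: mem_index_def)
  show ?thesis
  proof (cases "j < n")
    case True
    then have "mem i (j + 1) (0 + k)"
      using i j m by (intro mem_right[of i j "j + 1" k 0]) (auto simp: positive_def)
    moreover have "q + 1 = int (j + 1) + k * int n"
      using q by simp
    ultimately show ?thesis
      using mem_index_iff[of "j + 1" i k] True by (simp only: atLeastAtMost_iff) simp
  next
    case False
    then have "mem i 1 (1 + k)"
      using i j m n2 by (intro mem_right[of i j 1 k 1]) (auto simp: positive_def)
    moreover have "q + 1 = int 1 + (1 + k) * int n"
      using q False j by (simp add: algebra_simps)
    ultimately show ?thesis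
      using mem_index_iff[of 1 i "1 + k"] n2 by (simp only: atLeastAtMost_iff) simp
  qed
qed

lemma mem_index_pred:
  assumes i: "i \<in> {1..n}" "i' \<in> {1..n}" "i' < i" and "mem_index i q"
  shows "mem_index i' q"
proof -
  obtain j k where j: "j \<in> {1..n}" and q: "q = int j + k * int n" and m: "mem i j k"
    using assms by (auto simp: mem_index_def)
  then have "mem i' j (0 + k)"
    using i j m by (intro mem_left[of i j i' k 0]) (auto simp: positive_def)
  then show ?thesis
    using mem_index_iff[OF j, of i' k] q by simp
qed

text \<open>Bracketing with E(n,1) \<otimes> t moves row 1 to row n one degree higher; this is the
  source of g n \<le> g 1 + n.\<close>

lemma mem_index_wrap:
  assumes "mem_index 1 q"
  shows "mem_index n (q + int n)"
proof -
  obtain j k where j: "j \<in> {1..n}" and q: "q = int j + k * int n" and m: "mem 1 j k"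
    using assms by (auto simp: mem_index_def)
  then have "mem n j (1 + k)"
    using n2 j m by (intro mem_left[of 1 j n k 1]) (auto simp: positive_def)
  then show ?thesis
    using mem_index_iff[OF j, of n "1 + k"] q by (simp add: algebra_simps)
qed

text \<open>Natural numbers suffice for the minimum, as \<open>mem_index_greater\<close> forces q >
  i.\<close>

definition threshold :: "nat \<Rightarrow> nat" where
  "threshold i = (LEAST q. mem_index i (int q))"

lemma mem_index_threshold:
  assumes i: "i \<in> {1..n}"
  shows "mem_index i q \<longleftrightarrow> int (threshold i) \<le> q"
proof
  assume *: "mem_index i q"
  then have q: "int (nat q) = q"
    using mem_index_greater[OF i *] by simp
  then have "threshold i \<le> nat q"
    unfolding threshold_def using * by (intro Least_le) simp
  then show "int (threshold i) \<le> q"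
    using q by linarith
next
  assume "int (threshold i) \<le> q"
  then obtain d where q: "q = int (threshold i + d)"
    by (metis of_nat_add zle_iff_zadd)
  obtain j k where "j \<in> {1..n}" "mem i j k"
    using mem_exists[OF i] by blast
  then have *: "mem_index i (int j + k * int n)"
    by (simp add: mem_index_iff)
  then have "int (nat (int j + k * int n)) = int j + k * int n"
    using mem_index_greater[OF i *] by simp
  then have "mem_index i (int (nat (int j + k * int n)))"
    using * by simp
  then have "mem_index i (int (threshold i))"
    unfolding threshold_def by (rule LeastI)
  then have "mem_index i (int (threshold i + d))"
  proof (induction d)
    case (Suc d)
    then show ?case
      using mem_index_Suc[OF i, of "int (threshold i + d)"] by (simp add: ac_simps)
  qed simp
  then show "mem_index i q"
    by (simp add: q)
qed

lemma profile_exists: "\<exists>g\<in>profiles n. \<exists>m. I = profile_ideal n g m"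
proof -
  \<comment> \<open>The window for row 1 is 1 + m n < \<open>threshold 1\<close> \<le> 1 + (m + 1)
    n, so \<open>threshold 1 - 2\<close> lies between m n and m n + n - 1.\<close>
  define m where "m = (threshold 1 - 2) div n"
  have one: "1 \<in> {1..n}" and n: "n \<in> {1..n}"
    using n2 by auto
  have gt: "i < threshold i" if "i \<in> {1..n}" for i
    using mem_index_greater[OF that, of "int (threshold i)"] mem_index_threshold[OF that] by simp
  \<comment> \<open>The pair (i, i + k n) stands for the root k \<delta> whatever i is; this carries
    the window of row 1 over to all rows.\<close>
  have diag: "threshold i \<le> i + k * n \<longleftrightarrow> threshold j \<le> j + k * n"
    if "i \<in> {1..n}" "j \<in> {1..n}" for i j k
  proof -
    have "mem_index i (int i + int k * int n) = mem_index j (int j + int k * int n)"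
      using that by (simp add: mem_index_iff mem_diag)
    then show ?thesis
      unfolding mem_index_threshold[OF that(1)] mem_index_threshold[OF that(2)]
      by (metis of_nat_add of_nat_le_iff of_nat_mult)
  qed
  have t1: "threshold 1 - 2 = m * n + (threshold 1 - 2) mod n" "(threshold 1 - 2) mod n < n"
    using n2 by (simp_all add: m_def)
  then have "1 + m * n < threshold 1" "threshold 1 \<le> 1 + (m + 1) * n"
    using gt[OF one] by auto
  then have lo: "i + m * n < threshold i" and hi: "threshold i \<le> i + (m + 1) * n" if "i \<in> {1..n}" for i
    using diag[OF one that, of m] diag[OF one that, of "m + 1"] by auto
  define g where "g = (\<lambda>i\<in>{1..n}. threshold i - m * n)"
  have g: "threshold i = g i + m * n" if "i \<in> {1..n}" for i
    using lo[OF that] that by (simp add: g_def)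
  have "g i \<le> g j" if "i \<in> {1..n}" "j \<in> {1..n}" "i \<le> j" for i j
  proof (cases "i = j")
    case False
    then have "threshold i \<le> threshold j"
      using mem_index_pred[OF that(2,1), of "int (threshold j)"] that
      by (simp add: mem_index_threshold)
    then show ?thesis
      using that by (simp add: g)
  qed simp
  then have mono: "mono_on {1..n} g"
    by (auto simp: mono_on_def)
  have wrap: "g n \<le> g 1 + n"
    using mem_index_wrap[of "int (threshold 1)"] mem_index_threshold[OF one] mem_index_threshold[OF n]
    by (simp add: g[OF one] g[OF n] del: One_nat_def)
  have bounds: "i < g i \<and> g i \<le> i + n" if "i \<in> {1..n}" for i
    using lo[OF that] hi[OF that] by (simp add: g[OF that])
  have "g \<in> profiles n"
    unfolding profiles_def using bounds mono wrap by (simp add: g_def)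
  moreover have "mem i j k \<longleftrightarrow> above n g m i j k" if "i \<in> {1..n}" "j \<in> {1..n}" for i j k
    using mem_index_iff[OF that(2), of i k] mem_index_threshold[OF that(1)] that
    by (simp add: above_def g)
  then have "loop n mem = loop n (above n g m)"
    by (rule loop_cong)
  then have "I = profile_ideal n g m"
    using I_eq unfolding profile_ideal_def by simp
  ultimately show ?thesis
    by blast
qed

end

section \<open>Ideals given by profiles\<close>

lemma sl_sum: "(\<And>k. k \<in> K \<Longrightarrow> f k \<in> sl n) \<Longrightarrow> (\<Sum>k\<in>K. f k) \<in> sl n"
  by (induction K rule: infinite_finite_induct) (auto intro: sl_add)

lemma sl_outside: "A \<in> sl n \<Longrightarrow> \<not> (i \<in> {1..n} \<and> j \<in> {1..n}) \<Longrightarrow> A i j = 0"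
  unfolding sl_def matrices_def by blast

lemma commutator_sl:
  assumes "A \<in> sl n" "B \<in> sl n"
  shows "commutator n A B \<in> sl n"
proof -
  have "(\<Sum>i=1..n. \<Sum>l=1..n. A i l * B l i) = (\<Sum>i=1..n. \<Sum>l=1..n. B i l * A l i)"
    by (subst sum.swap) (simp add: mult.commute)
  then have "trace n (commutator n A B) = 0"
    by (simp add: trace_def commutator_def mmult_def sum_subtractf)
  moreover have "commutator n A B i j = 0" if "\<not> (i \<in> {1..n} \<and> j \<in> {1..n})" for i j
  proof -
    have *: "A i l * B l j = 0" "B i l * A l j = 0" for l
      using that sl_outside[OF assms(1)] sl_outside[OF assms(2)] by fastforce+
    then show ?thesis
      by (simp add: commutator_def mmult_def *)
  qed
  ultimately show ?thesis
    by (auto simp: sl_def matrices_def)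
qed

lemma commutator_entry:
  assumes "commutator n A B i j \<noteq> 0"
  obtains l where "A i l \<noteq> 0" "B l j \<noteq> 0" | l where "B i l \<noteq> 0" "A l j \<noteq> 0"
proof -
  have "(\<Sum>l=1..n. A i l * B l j) \<noteq> 0 \<or> (\<Sum>l=1..n. B i l * A l j) \<noteq> 0"
    using assms by (auto simp: commutator_def mmult_def)
  then have "(\<exists>l. A i l * B l j \<noteq> 0) \<or> (\<exists>l. B i l * A l j \<noteq> 0)"
    by (meson sum.neutral)
  then show ?thesis
    using that by auto
qed

text \<open>An entry (i,j) of a commutator arises through some intermediate index l, and degrees
  add, so closure of \<open>P\<close> under composition with positions of the Borel subalgebra on
  either side is what the bracket requires. The d-component only rescales degrees.\<close>

lemma borel_ideal_loop:
  assumes P: "\<And>i j k. P i j k \<Longrightarrow> positive i j k"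
    and left: "\<And>i l j a b. i \<in> {1..n} \<Longrightarrow> positive i l a \<or> i = l \<and> a = 0 \<Longrightarrow> P l j b \<Longrightarrow> P i j (a + b)"
    and right: "\<And>i l j a b. j \<in> {1..n} \<Longrightarrow> positive l j a \<or> l = j \<and> a = 0 \<Longrightarrow> P i l b \<Longrightarrow> P i j (a + b)"
  shows "borel_ideal n {(x, 0, 0) | x. x \<in> loop n P}"
  unfolding borel_ideal_def
proof (intro conjI ballI)
  show "{(x, 0, 0) | x. x \<in> loop n P} \<subseteq> borel n"
    using P by (auto simp: borel_eq elim!: loop_mono)
  show "affine.subspace {(x, 0, 0) | x. x \<in> loop n P}"
    by (rule subspace_loop)
  fix p q :: affine assume "p \<in> borel n" "q \<in> {(x, 0, 0) | x. x \<in> loop n P}"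
  then obtain x u v y where p: "p = (x, u, v)" and q: "q = (y, 0, 0)"
    and x: "x \<in> loop n (\<lambda>i j k. positive i j k \<or> i = j \<and> k = 0)" and y: "y \<in> loop n P"
    by (auto simp: borel_eq)
  define z where "z m = (\<Sum>k | x k \<noteq> 0. commutator n (x k) (y (m - k)))" for m
  \<comment> \<open>A nonzero term of the cocycle would put (i, i, 0) into \<open>P\<close>, which
    is not positive.\<close>
  have "trace n (mmult n (x k) (y (- k))) = 0" for k
  proof -
    have "x k i l * y (- k) l i = 0" if i: "i \<in> {1..n}" for i l
    proof (rule ccontr)
      assume "x k i l * y (- k) l i \<noteq> 0"
      then have "positive i l k \<or> i = l \<and> k = 0" "P l i (- k)"
        using x y by (auto simp: loop_def)
      from left[OF i this] P show False
        by (auto simp: positive_def)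
    qed
    then show ?thesis
      by (simp add: trace_def mmult_def sum.neutral)
  qed
  then have "bracket n p q = (z, 0, 0) + scale v ((\<lambda>m i j. of_int m * y m i j), 0, 0)"
    by (simp add: bracket_def p q z_def fun_eq_iff sum_fun_apply)
  moreover have "z \<in> loop n P"
  proof (rule loopI)
    have "{m. z m \<noteq> 0} \<subseteq> (\<lambda>(a, b). a + b) ` ({k. x k \<noteq> 0} \<times> {k. y k \<noteq> 0})"
    proof
      fix m assume "m \<in> {m. z m \<noteq> 0}"
      then obtain k where "x k \<noteq> 0" "commutator n (x k) (y (m - k)) \<noteq> 0"
        unfolding z_def by (auto elim: sum.not_neutral_contains_not_neutral)
      moreover have "commutator n (x k) 0 = 0"
        by (simp add: commutator_def mmult_def fun_eq_iff)
      ultimately have "x k \<noteq> 0" "y (m - k) \<noteq> 0"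
        by auto
      then have "(k, m - k) \<in> {k. x k \<noteq> 0} \<times> {k. y k \<noteq> 0}" "m = (\<lambda>(a, b). a + b) (k, m - k)"
        by auto
      then show "m \<in> (\<lambda>(a, b). a + b) ` ({k. x k \<noteq> 0} \<times> {k. y k \<noteq> 0})"
        by blast
    qed
    then show "finite {m. z m \<noteq> 0}"
      by (rule finite_subset) (use x y in \<open>auto simp: loop_def\<close>)
    show "z m \<in> sl n" for m
      unfolding z_def using x y by (intro sl_sum commutator_sl) (auto simp: loop_def)
    then have z_range: "i \<in> {1..n} \<and> j \<in> {1..n}" if "z m i j \<noteq> 0" for m i j
      using that unfolding sl_def matrices_def by blast
    fix i j m assume nz: "z m i j \<noteq> 0"
    then obtain k where "commutator n (x k) (y (m - k)) i j \<noteq> 0"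
      unfolding z_def sum_fun_apply by (auto elim: sum.not_neutral_contains_not_neutral)
    then show "P i j m"
    proof (cases rule: commutator_entry)
      case (1 l)
      then have "P i j (k + (m - k))"
        using x y z_range[OF nz] by (intro left[of i l]) (auto simp: loop_def)
      then show ?thesis by simp
    next
      case (2 l)
      then have "P i j (k + (m - k))"
        using x y z_range[OF nz] by (intro right[of j l]) (auto simp: loop_def)
      then show ?thesis by simp
    qed
  qed
  moreover have "(\<lambda>m i j. of_int m * y m i j) \<in> loop n P"
  proof (rule loopI)
    show "finite {m. (\<lambda>i j. of_int m * y m i j) \<noteq> 0}"
      by (rule finite_subset[of _ "{k. y k \<noteq> 0}"]) (use y in \<open>auto simp: loop_def fun_eq_iff\<close>)
  qed (use y in \<open>auto simp: loop_def sl_scale\<close>)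
  ultimately show "bracket n p q \<in> {(x, 0, 0) | x. x \<in> loop n P}"
    using loop_add loop_scale by (auto simp del: plus_fun_apply)
qed

text \<open>Two positions carry the same root only if they are equal or both diagonal of the same
  degree, so it suffices that \<open>P\<close> is constant on diagonals.\<close>

lemma thick_loop:
  assumes n: "n \<ge> 2"
    and P: "\<And>i j k. i \<in> {1..n} \<Longrightarrow> j \<in> {1..n} \<Longrightarrow> P i i k \<Longrightarrow> P j j k"
  shows "thick n {(x, 0, 0) | x. x \<in> loop n P}"
  unfolding thick_def
proof (intro ballI impI)
  let ?I = "{(x, 0, 0) | x. x \<in> loop n P} :: affine set"
  fix \<alpha> assume \<alpha>: "\<alpha> \<in> roots n" and ne: "?I \<inter> root_space n \<alpha> \<noteq> {0}"
  have sp: "root_space n \<alpha> = {(x, 0, 0) | x. x \<in> loop n (\<lambda>i j k. root_fun n i j k = \<alpha>)}"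
    using \<alpha> by (intro root_space_eq) (auto simp: roots_def)
  have "0 \<in> ?I \<inter> root_space n \<alpha>"
    unfolding sp zero_prod_def using loop_0 by blast
  then obtain p where p: "p \<in> ?I" "p \<in> root_space n \<alpha>" "p \<noteq> 0"
    using ne by blast
  obtain x where x: "x \<in> loop n P" "x \<in> loop n (\<lambda>i j k. root_fun n i j k = \<alpha>)" "x \<noteq> 0"
    using p unfolding sp by (auto simp: zero_prod_def)
  then obtain i j k where nz: "x k i j \<noteq> 0"
    by (auto simp: fun_eq_iff)
  then have ij: "i \<in> {1..n}" "j \<in> {1..n}" and Pk: "P i j k" and \<alpha>_eq: "root_fun n i j k = \<alpha>"
    using loop_range[OF x(1)] x by (auto simp: loop_def)
  have "P a b m" if "a \<in> {1..n}" "b \<in> {1..n}" "root_fun n a b m = \<alpha>" for a b m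
    using that root_eq_iff[of n a b i j m k] ij Pk P n unfolding \<alpha>_eq[symmetric] by auto
  then have "y \<in> loop n P" if "y \<in> loop n (\<lambda>i j k. root_fun n i j k = \<alpha>)" for y
    using that loop_range[OF that] by (simp add: loop_def)
  then show "root_space n \<alpha> \<subseteq> ?I"
    unfolding sp by blast
qed

text \<open>With auxiliary index 1 the diagonal part sums to the diagonal of A minus tr(A) E(1,1),
  and the trace is 0. The vector for i = j = 1 is 0 and does no harm.\<close>

lemma root_vector_sum:
  assumes A: "A \<in> sl n" and n: "n \<ge> 1"
  shows "A a b = (\<Sum>i=1..n. \<Sum>j=1..n. A i j * root_vector 1 i j a b)"
proof (cases "a \<in> {1..n} \<and> b \<in> {1..n}")
  case False
  with A have "A a b = 0"
    by (rule sl_outside)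
  moreover have "root_vector 1 i j a b = 0" if "i \<in> {1..n}" "j \<in> {1..n}" for i j
    using False n by (intro sl_outside[OF root_vector_sl[OF that]]) auto
  ultimately show ?thesis
    by simp
next
  case True
  have *: "A i j * root_vector 1 i j a b
      = (if j = b then if i = a then A a b else 0 else 0) - (if j = i then if a = 1 \<and> b = 1 then A i i else 0 else 0)"
    if "i \<in> {1..n}" "j \<in> {1..n}" for i j
    by (auto simp: root_vector_def matrix_unit_def)
  have "(\<Sum>i=1..n. \<Sum>j=1..n. A i j * root_vector 1 i j a b)
      = (\<Sum>i=1..n. \<Sum>j=1..n. (if j = b then if i = a then A a b else 0 else 0)
          - (if j = i then if a = 1 \<and> b = 1 then A i i else 0 else 0))"
    by (intro sum.cong refl *)
  also have "\<dots> = (\<Sum>i=1..n. (if i = a then A a b else 0) - (if a = 1 \<and> b = 1 then A i i else 0))"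
    using True by (intro sum.cong refl) (simp add: sum_subtractf)
  also have "\<dots> = A a b - (if a = 1 \<and> b = 1 then trace n A else 0)"
    using True by (cases "a = 1 \<and> b = 1") (simp_all only: sum_subtractf trace_def, simp_all)
  finally show ?thesis
    using A by (simp add: sl_def)
qed

text \<open>Degrees above \<open>K\<close> lie in the ideal, so c, d and the root vectors of degrees
  0 to \<open>K\<close> span a complement.\<close>

lemma finite_codim_loop:
  assumes n: "n \<ge> 1"
    and P: "\<And>i j k. i \<in> {1..n} \<Longrightarrow> j \<in> {1..n} \<Longrightarrow> K < k \<Longrightarrow> P i j k"
  shows "finite_codim n {(x, 0, 0) | x. x \<in> loop n P}"
proof -
  let ?I = "{(x, 0, 0) | x. x \<in> loop n P}"
  let ?T = "(\<lambda>(i, j, k). tensor (root_vector 1 i j) k) ` ({1..n} \<times> {1..n} \<times> {0..K})"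
  \<comment> \<open>The intersection discards the root vectors of degree 0 below the diagonal; they
    have coefficient 0 in every element of \<open>borel n\<close>.\<close>
  define F where "F = ({central, derivation} \<union> ?T) \<inter> borel n"
  have cd: "central \<in> borel n" "derivation \<in> borel n"
    using loop_0 by (auto simp: borel_eq central_def derivation_def)
  have "p \<in> affine.span (?I \<union> F)" if pb: "p \<in> borel n" for p
  proof -
    obtain x u v where p: "p = (x, u, v)" and x: "x \<in> loop n (\<lambda>i j k. positive i j k \<or> i = j \<and> k = 0)"
      using pb by (auto simp: borel_eq)
    let ?y = "\<lambda>k i j. if k \<le> K then x k i j else 0" and ?z = "\<lambda>k i j. if K < k then x k i j else 0"
    have y: "?y \<in> loop n (\<lambda>i j k. (positive i j k \<or> i = j \<and> k = 0) \<and> k \<le> K)"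
      and z: "?z \<in> loop n (\<lambda>i j k. (positive i j k \<or> i = j \<and> k = 0) \<and> K < k)"
      by (rule loop_restrict[OF x], rule refl)+
    have "?z \<in> loop n P"
      using z by (rule loop_mono) (simp add: P)
    then have "(?z, 0, 0) \<in> affine.span (?I \<union> F)"
      by (intro affine.span_base) blast
    moreover have "(?y, 0, 0) \<in> affine.span (?I \<union> F)"
    proof -
      have "0 \<le> k" if "x k i j \<noteq> 0" for i j k
        using x that by (force simp: loop_def positive_def)
      then have "{k. ?y k \<noteq> 0} \<subseteq> {0..K}"
        by (auto simp: fun_eq_iff split: if_splits)
      then have "(?y, 0, 0) = (\<Sum>k\<in>{0..K}. tensor (?y k) k)"
        by (intro tensor_sum) auto
      also have "\<dots> = (\<Sum>k\<in>{0..K}. \<Sum>i=1..n. \<Sum>j=1..n. scale (x k i j) (tensor (root_vector 1 i j) k))"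
      proof (intro sum.cong refl)
        fix k assume k: "k \<in> {0..K}"
        have "x k \<in> sl n"
          using x by (simp add: loop_def)
        then have "x k = (\<lambda>a b. \<Sum>i=1..n. \<Sum>j=1..n. x k i j * root_vector 1 i j a b)"
          using n by (intro ext root_vector_sum)
        moreover have "?y k = x k"
          using k by simp
        ultimately have "?y k = (\<lambda>a b. \<Sum>i=1..n. \<Sum>j=1..n. x k i j * root_vector 1 i j a b)"
          by (rule trans[rotated])
        then show "tensor (?y k) k = (\<Sum>i=1..n. \<Sum>j=1..n. scale (x k i j) (tensor (root_vector 1 i j) k))"
          by (simp only:) (simp add: tensor_def sum_prod fun_eq_iff sum_fun_apply)
      qed
      also have "\<dots> \<in> affine.span (?I \<union> F)"
      proof (intro affine.span_sum)
        fix k i j assume ijk: "k \<in> {0..K}" "i \<in> {1..n}" "j \<in> {1..n}"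
        show "scale (x k i j) (tensor (root_vector 1 i j) k) \<in> affine.span (?I \<union> F)"
        proof (cases "x k i j = 0")
          case True
          then show ?thesis
            using affine.span_zero by simp
        next
          case False
          then have "positive i j k \<or> i = j \<and> k = 0"
            using x by (auto simp: loop_def)
          then have "positive a b k \<or> a = b \<and> k = 0" if "root_vector 1 i j a b \<noteq> 0" for a b
            using that by (auto simp: root_vector_def matrix_unit_def positive_def split: if_splits)
          then have "tensor (root_vector 1 i j) k \<in> borel n"
            using tensor_in_loop[OF root_vector_sl[of i n j 1], of "\<lambda>a b k. positive a b k \<or> a = b \<and> k = 0" k]
              ijk n by (auto simp: borel_eq)
          then have "tensor (root_vector 1 i j) k \<in> F"
            using ijk unfolding F_def by (intro IntI UnI2 image_eqI[of _ _ "(i, j, k)"]) simp_all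
          then show ?thesis
            by (intro affine.span_scale affine.span_base UnI2)
        qed
      qed
      finally show ?thesis .
    qed
    moreover have "scale u central \<in> affine.span (?I \<union> F)" "scale v derivation \<in> affine.span (?I \<union> F)"
      using cd by (intro affine.span_scale affine.span_base UnI2; simp add: F_def)+
    ultimately have "(?z, 0, 0) + (?y, 0, 0) + scale u central + scale v derivation \<in> affine.span (?I \<union> F)"
      by (intro affine.span_add)
    moreover have "p = (?z, 0, 0) + (?y, 0, 0) + scale u central + scale v derivation"
      by (simp add: p central_def derivation_def) (simp add: fun_eq_iff)
    ultimately show ?thesis
      by (simp only:)
  qed
  moreover have "finite F" "F \<subseteq> borel n"
    by (auto simp: F_def)
  ultimately show ?thesis
    unfolding finite_codim_def by blast
qed

section \<open>Closure properties of the positions above a profile\<close>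

lemma positive_index:
  assumes "i \<in> {1..n}" "j \<in> {1..n}"
  shows "int i < int j + k * int n \<longleftrightarrow> positive i j k"
proof -
  have ij: "1 \<le> int i" "1 \<le> int j" "int i \<le> int n" "int j \<le> int n"
    using assms by auto
  consider "k < 0" | "k = 0" | "k > 0"
    by linarith
  then show ?thesis
  proof cases
    case 1
    then have "k * int n \<le> - int n"
      using mult_right_mono[of k "- 1" "int n"] by simp
    then have "\<not> int i < int j + k * int n"
      using ij by linarith
    then show ?thesis
      using 1 by (simp add: positive_def)
  next
    case 3
    then have "int n \<le> k * int n"
      using mult_right_mono[of 1 k "int n"] by simp
    then have "int i < int j + k * int n"
      using ij by linarith
    then show ?thesis
      using 3 by (simp add: positive_def)
  qed (simp add: positive_def)
qed

text \<open>Because g i - i lies in \<open>{1..n}\<close>, the first number congruent to i that is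
  at least g i + m n is i + (m + 1) n. The outcome is the same for all i, which is what thickness
  demands.\<close>

lemma above_diag:
  assumes "g \<in> profiles n" "i \<in> {1..n}"
  shows "above n g m i i k \<longleftrightarrow> int m < k"
proof -
  have gt: "int i < int (g i)" and le: "int (g i) \<le> int i + int n"
    using profilesD(1,2)[OF assms(1), of i] assms(2) by auto
  show ?thesis
  proof (cases "int m < k")
    case True
    then have "(int m + 1) * int n \<le> k * int n"
      by (intro mult_right_mono) auto
    then have "int m * int n + int n \<le> k * int n"
      by (simp add: algebra_simps)
    then have "int (g i) + int m * int n \<le> int i + k * int n"
      using le by linarith
    then show ?thesis
      using True assms(2) by (simp add: above_def)
  next
    case False
    then have "k * int n \<le> int m * int n"
      by (intro mult_right_mono) auto
    then have "\<not> int (g i) + int m * int n \<le> int i + k * int n"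
      using gt by linarith
    then show ?thesis
      using False assms(2) by (simp add: above_def)
  qed
qed

lemma above_positive:
  assumes g: "g \<in> profiles n" and ab: "above n g m i j k"
  shows "positive i j k"
proof -
  have "int i < int (g i)" "0 \<le> int m * int n"
    using profilesD(1)[OF g] ab by (auto simp: above_def)
  moreover have "int (g i) + int m * int n \<le> int j + k * int n"
    using ab by (simp add: above_def)
  ultimately have "int i < int j + k * int n"
    by linarith
  then show ?thesis
    using ab positive_index[of i n j k] by (simp add: above_def)
qed

text \<open>In degree a = 0 this is monotonicity. In degree a \<ge> 1 the chain g i \<le> g n \<le>
  g 1 + n \<le> g l + a n uses the wrap condition.\<close>

lemma above_left:
  assumes g: "g \<in> profiles n" and i: "i \<in> {1..n}"
    and pos: "positive i l a \<or> i = l \<and> a = 0" and ab: "above n g m l j b"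
  shows "above n g m i j (a + b)"
proof -
  have l: "l \<in> {1..n}"
    using ab by (simp add: above_def)
  have "int (g i) \<le> int (g l) + a * int n"
  proof (cases "a \<ge> 1")
    case True
    then have "int n \<le> a * int n"
      using mult_right_mono[of 1 a "int n"] by simp
    moreover have "g i \<le> g n" "g 1 \<le> g l" "g n \<le> g 1 + n"
      using profilesD(3,4)[OF g] i l by auto
    ultimately show ?thesis
      by linarith
  next
    case False
    then have "a = 0" "i \<le> l"
      using pos by (auto simp: positive_def)
    then show ?thesis
      using profilesD(3)[OF g i l] by simp
  qed
  then show ?thesis
    using ab i by (simp add: above_def algebra_simps)
qed

lemma above_right:
  assumes j: "j \<in> {1..n}"
    and pos: "positive l j a \<or> l = j \<and> a = 0" and ab: "above n g m i l b"
  shows "above n g m i j (a + b)"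
proof -
  have "int l \<le> int j + a * int n"
    using pos positive_index[of l n j a] ab j by (auto simp: above_def)
  then show ?thesis
    using ab j by (simp add: above_def algebra_simps)
qed

lemma above_large:
  assumes "g \<in> profiles n" "i \<in> {1..n}" "j \<in> {1..n}" "int m + 1 < k"
  shows "above n g m i j k"
proof -
  have "(int m + 2) * int n \<le> k * int n"
    using assms(4) by (intro mult_right_mono) auto
  then have "int m * int n + 2 * int n \<le> k * int n"
    by (simp add: algebra_simps)
  then show ?thesis
    using profilesD(2)[OF assms(1,2)] assms(2,3) unfolding above_def atLeastAtMost_iff by linarith
qed

lemma profile_ideal_combinatorial:
  assumes n: "n \<ge> 2" and g: "g \<in> profiles n"
  shows "profile_ideal n g m \<in> combinatorial_ideals n"
proof -
  have "borel_ideal n (profile_ideal n g m)"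
    unfolding profile_ideal_def
    using above_positive[OF g] above_left[OF g] above_right by (rule borel_ideal_loop)
  moreover have "thick n (profile_ideal n g m)"
    unfolding profile_ideal_def by (rule thick_loop[OF n]) (simp add: above_diag[OF g])
  moreover have "finite_codim n (profile_ideal n g m)"
    unfolding profile_ideal_def
    by (rule finite_codim_loop[of n "int m + 1"]) (use n above_large[OF g] in auto)
  moreover have "profile_ideal n g m \<subseteq> nplus n"
    using above_positive[OF g] by (auto simp: profile_ideal_def nplus_eq elim!: loop_mono)
  ultimately show ?thesis
    by (simp add: combinatorial_ideals_def strong_def)
qed

section \<open>Supports and equivalence of profile ideals\<close>

lemma supp_profile_ideal:
  assumes n: "n \<ge> 2" and g: "g \<in> profiles n"
  shows "supp n (profile_ideal n g m) = {root_fun n i j k | i j k. above n g m i j k}"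
proof (intro antisym subsetI)
  fix \<alpha> assume "\<alpha> \<in> supp n (profile_ideal n g m)"
  then obtain i j k where ij: "i \<in> {1..n}" "j \<in> {1..n}" "i \<noteq> j \<or> k \<noteq> 0" and \<alpha>: "\<alpha> = root_fun n i j k"
    and sub: "root_space n \<alpha> \<subseteq> profile_ideal n g m"
    unfolding supp_def roots_iff[OF n] by blast
  obtain l where l: "l \<in> {1..n}" "l \<noteq> i"
    using exists_other[OF n] by blast
  then have "tensor (root_vector l i j) k \<in> profile_ideal n g m"
    using root_vector_root_space[OF ij(1,2) l(1) ij(3)] sub \<alpha> by blast
  then have "above n g m i j k"
    using root_vector_nonzero[OF l(2), of j]
    by (auto simp: profile_ideal_def tensor_def loop_def dest: spec[of _ k])
  then show "\<alpha> \<in> {root_fun n i j k | i j k. above n g m i j k}"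
    using \<alpha> by blast
next
  fix \<alpha> assume "\<alpha> \<in> {root_fun n i j k | i j k. above n g m i j k}"
  then obtain i j k where ab: "above n g m i j k" and \<alpha>: "\<alpha> = root_fun n i j k"
    by blast
  have ij: "i \<in> {1..n}" "j \<in> {1..n}" "n \<ge> 1" and nz: "i \<noteq> j \<or> k \<noteq> 0"
    using ab above_positive[OF g ab] by (auto simp: above_def positive_def)
  have "x \<in> loop n (above n g m)" if "x \<in> loop n (\<lambda>a b m. root_fun n a b m = root_fun n i j k)" for x
    using that
  proof (rule loop_mono)
    fix a b c assume *: "a \<in> {1..n}" "b \<in> {1..n}" "root_fun n a b c = root_fun n i j k"
    then show "above n g m a b c"
      using root_eq_iff[OF ij(3) *(1,2) ij(1,2)] ab above_diag[OF g ij(1)] above_diag[OF g *(1)] by auto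
  qed
  then have "root_space n \<alpha> \<subseteq> profile_ideal n g m"
    unfolding \<alpha> root_space_root[OF ij(3,1,2) nz] profile_ideal_def by blast
  then show "\<alpha> \<in> supp n (profile_ideal n g m)"
    using ij nz \<alpha> unfolding supp_def roots_iff[OF n] by blast
qed

lemma delta_shift: "(\<lambda>h. of_int k * delta n h + root_fun n i j l h) = root_fun n i j (k + l)"
  by (simp add: root_fun_def delta_def fun_eq_iff algebra_simps)

lemma image_delta_shift:
  "(\<lambda>\<alpha> h. of_int k * delta n h + \<alpha> h) ` {root_fun n i j l | i j l. P i j l}
    = {root_fun n i j (k + l) | i j l. P i j l}" (is "?f ` ?A = ?B")
proof (intro antisym subsetI)
  fix \<alpha> assume "\<alpha> \<in> ?f ` ?A"
  then obtain i j l where "\<alpha> = ?f (root_fun n i j l)" "P i j l"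
    by blast
  then show "\<alpha> \<in> ?B"
    unfolding delta_shift by blast
next
  fix \<alpha> assume "\<alpha> \<in> ?B"
  then obtain i j l where "\<alpha> = root_fun n i j (k + l)" "P i j l"
    by blast
  then show "\<alpha> \<in> ?f ` ?A"
    unfolding delta_shift[symmetric] by blast
qed

text \<open>Changing m shifts the support by a multiple of \<delta>, which gives one direction.
  Conversely the imaginary roots in the two supports reveal the shift k = m - m', and after undoing
  it the thresholds can be compared row by row.\<close>

lemma ideal_equiv_profile:
  assumes n: "n \<ge> 2" and g: "g \<in> profiles n" and g': "g' \<in> profiles n"
  shows "(profile_ideal n g m, profile_ideal n g' m') \<in> ideal_equiv n \<longleftrightarrow> g = g'"
proof
  assume gg: "g = g'"
  have shift: "above n g m i j k \<longleftrightarrow> above n g' m' i j (k - (int m - int m'))" for i j k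
    by (simp add: above_def gg algebra_simps)
  have "supp n (profile_ideal n g m)
      = {root_fun n i j ((int m - int m') + l) | i j l. above n g' m' i j l}"
    unfolding supp_profile_ideal[OF n g] shift
  proof (intro antisym subsetI)
    fix \<alpha> assume "\<alpha> \<in> {root_fun n i j k |i j k. above n g' m' i j (k - (int m - int m'))}"
    then obtain i j k where "\<alpha> = root_fun n i j ((int m - int m') + (k - (int m - int m')))"
      "above n g' m' i j (k - (int m - int m'))"
      by auto
    then show "\<alpha> \<in> {root_fun n i j ((int m - int m') + l) | i j l. above n g' m' i j l}"
      by blast
  next
    fix \<alpha> assume "\<alpha> \<in> {root_fun n i j ((int m - int m') + l) | i j l. above n g' m' i j l}"
    then obtain i j l where "\<alpha> = root_fun n i j ((int m - int m') + l)" "above n g' m' i j l"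
      by blast
    then have "\<alpha> = root_fun n i j ((int m - int m') + l)"
      "above n g' m' i j ((int m - int m') + l - (int m - int m'))"
      by simp_all
    then show "\<alpha> \<in> {root_fun n i j k |i j k. above n g' m' i j (k - (int m - int m'))}"
      by blast
  qed
  also have "\<dots> = (\<lambda>\<alpha> h. of_int (int m - int m') * delta n h + \<alpha> h) ` supp n (profile_ideal n g' m')"
    unfolding supp_profile_ideal[OF n g'] image_delta_shift ..
  finally show "(profile_ideal n g m, profile_ideal n g' m') \<in> ideal_equiv n"
    unfolding ideal_equiv_def using profile_ideal_combinatorial[OF n] g g' by blast
next
  assume "(profile_ideal n g m, profile_ideal n g' m') \<in> ideal_equiv n"
  then obtain k where k: "supp n (profile_ideal n g m)
      = (\<lambda>\<alpha> h. of_int k * delta n h + \<alpha> h) ` supp n (profile_ideal n g' m')"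
    by (auto simp: ideal_equiv_def)
  have n1: "n \<ge> 1"
    using n by simp
  have root_above: "root_fun n i j l \<in> supp n (profile_ideal n f p) \<longleftrightarrow> above n f p i j l"
    if ij: "i \<in> {1..n}" "j \<in> {1..n}" and f: "f \<in> profiles n" for i j l f p
  proof
    assume "root_fun n i j l \<in> supp n (profile_ideal n f p)"
    then obtain a b c where ab: "above n f p a b c" and eq: "root_fun n i j l = root_fun n a b c"
      unfolding supp_profile_ideal[OF n f] by auto
    then have "a \<in> {1..n}" "b \<in> {1..n}"
      by (auto simp: above_def)
    then show "above n f p i j l"
      using root_eq_iff[OF n1 ij, of a b l c] eq ab above_diag[OF f] ij by auto
  qed (auto simp: supp_profile_ideal[OF n f])
  have eq: "above n g m i j l \<longleftrightarrow> above n g' m' i j (l - k)" if "i \<in> {1..n}" "j \<in> {1..n}" for i j l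
  proof -
    have "root_fun n i j l \<in> supp n (profile_ideal n g m) \<longleftrightarrow> root_fun n i j (l - k) \<in> supp n (profile_ideal n g' m')"
    proof
      assume "root_fun n i j l \<in> supp n (profile_ideal n g m)"
      then obtain a b c where ab: "above n g' m' a b c" and eq: "root_fun n i j l = root_fun n a b (k + c)"
        unfolding k supp_profile_ideal[OF n g'] image_delta_shift by blast
      then have "root_fun n i j (l - k) = root_fun n a b c"
        using root_eq_iff[OF n1 that] ab by (auto simp: above_def)
      then show "root_fun n i j (l - k) \<in> supp n (profile_ideal n g' m')"
        unfolding supp_profile_ideal[OF n g'] using ab by blast
    next
      assume "root_fun n i j (l - k) \<in> supp n (profile_ideal n g' m')"
      moreover have "root_fun n i j l = (\<lambda>h. of_int k * delta n h + root_fun n i j (l - k) h)"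
        unfolding delta_shift by simp
      ultimately show "root_fun n i j l \<in> supp n (profile_ideal n g m)"
        unfolding k by (intro image_eqI[where x = "root_fun n i j (l - k)"])
    qed
    then show ?thesis
      using root_above[OF that g] root_above[OF that g'] by simp
  qed
  have "above n g m 1 1 l \<longleftrightarrow> above n g' m' 1 1 (l - k)" for l
    using n by (intro eq) auto
  then have "int m < l \<longleftrightarrow> int m' < l - k" for l
    using above_diag[OF g, of 1] above_diag[OF g', of 1] n by auto
  from this[of "int m + 1"] this[of "int m' + k + 1"] have km: "k = int m - int m'"
    by linarith
  \<comment> \<open>Every integer has the form j + l n with j in \<open>{1..n}\<close>, so
    membership of roots tests the thresholds against all q.\<close>
  have "int (g i) \<le> q \<longleftrightarrow> int (g' i) \<le> q" if i: "i \<in> {1..n}" for i q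
  proof -
    obtain j l where j: "j \<in> {1..n}" and q: "q + int m * int n = int j + l * int n"
      using residue_exists[OF n1] by blast
    then have "q + int m' * int n = int j + (l - k) * int n"
      by (simp add: km algebra_simps)
    then show ?thesis
      using eq[OF i j, of l] i j q unfolding above_def by (smt (verit))
  qed
  then have "g i = g' i" if "i \<in> {1..n}" for i
    using that by (metis order.refl of_nat_le_iff antisym)
  moreover have "g \<in> extensional {1..n}" "g' \<in> extensional {1..n}"
    using g g' by (auto simp: profiles_def)
  ultimately show "g = g'"
    by (intro extensionalityI)
qed

lemma finite_profiles: "finite (profiles n)"
proof (rule finite_subset)
  show "profiles n \<subseteq> (\<Pi>\<^sub>E i\<in>{1..n}. {..i + n})"
    by (auto simp: profiles_def PiE_def)
qed (auto intro: finite_PiE)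

text \<open>A class consists of the ideals \<open>profile_ideal n g m\<close> for one g and all m; m
  = 0 picks a representative.\<close>

lemma bij_betw_profiles:
  assumes n: "n \<ge> 2"
  shows "bij_betw (\<lambda>g. ideal_equiv n `` {profile_ideal n g 0}) (profiles n)
    (combinatorial_ideals n // ideal_equiv n)"
  unfolding bij_betw_def
proof
  note equiv = equiv_ideal_equiv[of n]
  show "inj_on (\<lambda>g. ideal_equiv n `` {profile_ideal n g 0}) (profiles n)"
    using ideal_equiv_profile[OF n] eq_equiv_class[OF _ equiv] profile_ideal_combinatorial[OF n]
    by (intro inj_onI) blast
  have "\<exists>g\<in>profiles n. ideal_equiv n `` {I} = ideal_equiv n `` {profile_ideal n g 0}"
    if I: "I \<in> combinatorial_ideals n" for I
  proof -
    interpret combinatorial_ideal n I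
      using n I by unfold_locales
    obtain g m where "g \<in> profiles n" "I = profile_ideal n g m"
      using profile_exists by blast
    then show ?thesis
      using ideal_equiv_profile[OF n] equiv_class_eq[OF equiv] by blast
  qed
  then show "(\<lambda>g. ideal_equiv n `` {profile_ideal n g 0}) ` profiles n = combinatorial_ideals n // ideal_equiv n"
    using profile_ideal_combinatorial[OF n] by (auto simp: quotient_def) blast+
qed

section \<open>Counting profiles\<close>

text \<open>These are Dyck paths in disguise, or ideals of the Borel subalgebra of sl(n) inside its
  nilradical: row i occupies the columns from \<open>u i\<close> on, and the value n + 1 marks an
  empty row.\<close>

definition staircases :: "nat \<Rightarrow> (nat \<Rightarrow> nat) set" where
  "staircases n = {u \<in> extensional {1..n}. (\<forall>i\<in>{1..n}. i < u i \<and> u i \<le> n + 1) \<and> mono_on {1..n} u}"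

definition top_count :: "nat \<Rightarrow> (nat \<Rightarrow> nat) \<Rightarrow> nat" where
  "top_count n u = card {i \<in> {1..n}. u i = n + 1}"

lemma staircasesI:
  assumes "u \<in> extensional {1..n}" "\<And>i. i \<in> {1..n} \<Longrightarrow> i < u i" "\<And>i. i \<in> {1..n} \<Longrightarrow> u i \<le> n + 1"
    and "\<And>i j. i \<in> {1..n} \<Longrightarrow> j \<in> {1..n} \<Longrightarrow> i \<le> j \<Longrightarrow> u i \<le> u j"
  shows "u \<in> staircases n"
  using assms by (simp add: staircases_def mono_on_def)

lemma staircasesD:
  assumes "u \<in> staircases n"
  shows "i \<in> {1..n} \<Longrightarrow> i < u i" "i \<in> {1..n} \<Longrightarrow> u i \<le> n + 1"
    "i \<in> {1..n} \<Longrightarrow> j \<in> {1..n} \<Longrightarrow> i \<le> j \<Longrightarrow> u i \<le> u j"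
    "u \<in> extensional {1..n}"
  using assms by (simp_all add: staircases_def mono_on_def)

lemma reflect:
  fixes p n :: nat
  assumes "p \<in> {1..n}"
  shows "n + 1 - p \<in> {1..n}" "n + 1 - (n + 1 - p) = p"
  using assms by auto

lemma finite_staircases: "finite (staircases n)"
proof (rule finite_subset)
  show "staircases n \<subseteq> (\<Pi>\<^sub>E i\<in>{1..n}. {..n + 1})"
    by (auto simp: staircases_def PiE_def)
qed (auto intro: finite_PiE)

lemma staircase_last: "u \<in> staircases n \<Longrightarrow> n \<ge> 1 \<Longrightarrow> u n = n + 1"
  using staircasesD(1,2)[of u n n] by simp

lemma top_count_le: "top_count n u \<le> n"
proof -
  have "top_count n u \<le> card {1..n}"
    unfolding top_count_def by (rule card_mono) auto
  then show ?thesis by simp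
qed

lemma top_count_ge_1:
  assumes "u \<in> staircases n" "n \<ge> 1"
  shows "1 \<le> top_count n u"
proof -
  have "n \<in> {i \<in> {1..n}. u i = n + 1}"
    using staircase_last[OF assms] assms(2) by simp
  then have "card {n} \<le> top_count n u"
    unfolding top_count_def by (intro card_mono) auto
  then show ?thesis by simp
qed

text \<open>By monotonicity the maximal entries form a final segment, which must start after
  i.\<close>

lemma top_count_less:
  assumes u: "u \<in> staircases n" and i: "i \<in> {1..n}" and ne: "u i \<noteq> n + 1"
  shows "top_count n u + i \<le> n"
proof -
  have "{j \<in> {1..n}. u j = n + 1} \<subseteq> {Suc i..n}"
  proof
    fix j assume j: "j \<in> {j \<in> {1..n}. u j = n + 1}"
    have "\<not> j \<le> i"
      using staircasesD(3)[OF u, of j i] staircasesD(2)[OF u i] i j ne by auto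
    then show "j \<in> {Suc i..n}"
      using j by auto
  qed
  then have "top_count n u \<le> card {Suc i..n}"
    unfolding top_count_def by (intro card_mono) auto
  then have "top_count n u \<le> n - i"
    by simp
  moreover have "i \<le> n"
    using i by simp
  ultimately show ?thesis
    by linarith
qed

lemma top_count_eq_iff:
  assumes u: "u \<in> staircases n" and n: "n \<ge> 1"
  shows "top_count n u = n \<longleftrightarrow> u 1 = n + 1"
proof
  assume "top_count n u = n"
  then show "u 1 = n + 1"
    using top_count_less[OF u, of 1] n by fastforce
next
  assume *: "u 1 = n + 1"
  have "u i = n + 1" if "i \<in> {1..n}" for i
    using staircasesD(3)[OF u, of 1 i] staircasesD(2)[OF u that] that * by auto
  then have "{i \<in> {1..n}. u i = n + 1} = {1..n}"
    by auto
  then show "top_count n u = n"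
    by (simp add: top_count_def)
qed

lemma staircases_constant: "{u \<in> staircases n. \<forall>i\<in>{1..n}. u i = n + 1} = {\<lambda>i\<in>{1..n}. n + 1}"
proof (intro antisym subsetI)
  fix u assume u: "u \<in> {u \<in> staircases n. \<forall>i\<in>{1..n}. u i = n + 1}"
  then have "u = (\<lambda>i\<in>{1..n}. n + 1)"
    using staircasesD(4)[of u n] by (intro extensionalityI[of _ "{1..n}"]) auto
  then show "u \<in> {\<lambda>i\<in>{1..n}. n + 1}"
    by simp
next
  fix u assume "u \<in> {\<lambda>i\<in>{1..n}. n + 1}"
  then show "u \<in> {u \<in> staircases n. \<forall>i\<in>{1..n}. u i = n + 1}"
    by (auto intro!: staircasesI)
qed

section \<open>Refined count of staircases and the matrices \<open>C_matrix\<close>\<close>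

lemma card_fibres:
  assumes "finite S" "finite T"
  shows "card {s \<in> S. f s \<in> T} = (\<Sum>t\<in>T. card {s \<in> S. f s = t})"
proof -
  have "{s \<in> S. f s \<in> T} = (\<Union>t\<in>T. {s \<in> S. f s = t})"
    by auto
  moreover have "card (\<Union>t\<in>T. {s \<in> S. f s = t}) = (\<Sum>t\<in>T. card {s \<in> S. f s = t})"
    by (rule card_UN_disjoint) (use assms in auto)
  ultimately show ?thesis
    by simp
qed

text \<open>The offset in \<open>u 1 = x + 1\<close> makes both statistics run over
  \<open>{1..n}\<close>, the index range of the matrices.\<close>

definition refined_count :: "nat \<Rightarrow> nat \<Rightarrow> nat \<Rightarrow> nat" where
  "refined_count n x y = card {u \<in> staircases n. u 1 = x + 1 \<and> top_count n u = y}"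

text \<open>The first entry is maximal exactly if all entries are, so x = n and y = n go together.
  This is the block shape of \<open>C_matrix\<close>: the last row and column vanish off the
  corner.\<close>

lemma refined_count_eq_0:
  assumes n: "n \<ge> 1" and "\<not> (x \<in> {1..n} \<and> y \<in> {1..n}) \<or> (x = n) \<noteq> (y = n)"
  shows "refined_count n x y = 0"
proof -
  have "{u \<in> staircases n. u 1 = x + 1 \<and> top_count n u = y} = {}"
  proof (rule ccontr)
    assume "\<not> ?thesis"
    then obtain u where u: "u \<in> staircases n" "u 1 = x + 1" "top_count n u = y"
      by blast
    then have "x \<in> {1..n} \<and> y \<in> {1..n} \<and> (x = n \<longleftrightarrow> y = n)"
      using staircasesD(1,2)[OF u(1), of 1] top_count_le[of n u] top_count_ge_1[OF u(1) n]
        top_count_eq_iff[OF u(1) n] n by auto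
    then show False
      using assms(2) by blast
  qed
  then show ?thesis
    by (simp only: refined_count_def card.empty)
qed

lemma refined_count_top:
  assumes n: "n \<ge> 1"
  shows "refined_count n n n = 1"
proof -
  have "(u 1 = n + 1 \<and> top_count n u = n) \<longleftrightarrow> (\<forall>i\<in>{1..n}. u i = n + 1)" if u: "u \<in> staircases n" for u
  proof
    assume *: "u 1 = n + 1 \<and> top_count n u = n"
    show "\<forall>i\<in>{1..n}. u i = n + 1"
      using top_count_less[OF u] * by force
  next
    assume "\<forall>i\<in>{1..n}. u i = n + 1"
    then show "u 1 = n + 1 \<and> top_count n u = n"
      using top_count_eq_iff[OF u n] n by auto
  qed
  then have "{u \<in> staircases n. u 1 = n + 1 \<and> top_count n u = n} = {\<lambda>i\<in>{1..n}. n + 1}"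
    unfolding staircases_constant[symmetric] by blast
  then show ?thesis
    by (simp only: refined_count_def card.empty card.insert finite.emptyI) simp
qed

text \<open>Removing the first entry and lowering the others by one turns staircases of size
  \<open>n + 1\<close> into staircases of size \<open>n\<close>.\<close>

lemma refined_count_Suc:
  assumes x: "x \<in> {1..n}"
  shows "refined_count (Suc n) x y = (\<Sum>s=x-1..n. refined_count n s y)"
proof -
  let ?A = "{u \<in> staircases (Suc n). u 1 = x + 1 \<and> top_count (Suc n) u = y}"
  let ?B = "{v \<in> staircases n. x \<le> v 1 \<and> top_count n v = y}"
  define \<phi> where "\<phi> u = (\<lambda>i\<in>{1..n}. u (Suc i) - 1)" for u :: "nat \<Rightarrow> nat"
  define \<psi> where "\<psi> v = (\<lambda>i\<in>{1..Suc n}. if i = 1 then x + 1 else v (i - 1) + 1)" for v :: "nat \<Rightarrow> nat"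
  \<comment> \<open>The removed first entry is x + 1 < n + 2, hence not maximal, and removing it
    does not change the number of maximal entries.\<close>
  have top: "top_count (Suc n) u = top_count n v"
    if "u 1 \<noteq> n + 2" "\<And>i. i \<in> {1..n} \<Longrightarrow> u (Suc i) = Suc (v i)" for u v
  proof -
    have "{i \<in> {1..Suc n}. u i = Suc n + 1} = Suc ` {i \<in> {1..n}. v i = n + 1}"
    proof (intro antisym subsetI)
      fix i assume i: "i \<in> {i \<in> {1..Suc n}. u i = Suc n + 1}"
      with that(1) have "i \<noteq> 1"
        by auto
      then obtain j where j: "i = Suc j" "j \<in> {1..n}"
        using i by (cases i) auto
      then show "i \<in> Suc ` {i \<in> {1..n}. v i = n + 1}"
        using i that(2)[of j] by auto
    next
      fix i assume "i \<in> Suc ` {i \<in> {1..n}. v i = n + 1}"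
      then show "i \<in> {i \<in> {1..Suc n}. u i = Suc n + 1}"
        using that(2) by auto
    qed
    then show ?thesis
      by (simp add: top_count_def card_image del: One_nat_def)
  qed
  have "bij_betw \<phi> ?A ?B"
  proof (rule bij_betw_byWitness[where f' = \<psi>])
    have pos: "0 < u (Suc i)" if "u \<in> staircases (Suc n)" "i \<in> {1..n}" for u i
      using staircasesD(1)[OF that(1), of "Suc i"] that(2) by auto
    show "\<forall>u\<in>?A. \<psi> (\<phi> u) = u"
    proof
      fix u assume u: "u \<in> ?A"
      have "\<psi> (\<phi> u) i = u i" if i: "i \<in> {1..Suc n}" for i
      proof (cases "i = 1")
        case False
        then obtain j where j: "i = Suc j" "j \<in> {1..n}"
          using i by (cases i) auto
        then show ?thesis
          using pos[of u j] u i by (simp add: \<psi>_def \<phi>_def)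
      qed (use u in \<open>simp add: \<psi>_def\<close>)
      then show "\<psi> (\<phi> u) = u"
        using staircasesD(4)[of u "Suc n"] u
        by (intro extensionalityI[of _ "{1..Suc n}"]) (auto simp: \<psi>_def)
    qed
    show "\<forall>v\<in>?B. \<phi> (\<psi> v) = v"
    proof
      fix v assume v: "v \<in> ?B"
      then show "\<phi> (\<psi> v) = v"
        using staircasesD(4)[of v n]
        by (intro extensionalityI[of _ "{1..n}"]) (auto simp: \<psi>_def \<phi>_def)
    qed
    show "\<phi> ` ?A \<subseteq> ?B"
    proof (rule image_subsetI)
      fix u assume "u \<in> ?A"
      then have u: "u \<in> staircases (Suc n)" and u1: "u 1 = x + 1" and y: "top_count (Suc n) u = y"
        by auto
      have "\<phi> u \<in> staircases n"
      proof (rule staircasesI)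
        fix i assume i: "i \<in> {1..n}"
        show "i < \<phi> u i" "\<phi> u i \<le> n + 1"
          using staircasesD(1,2)[OF u, of "Suc i"] i by (auto simp: \<phi>_def)
        fix j assume "j \<in> {1..n}" "i \<le> j"
        then show "\<phi> u i \<le> \<phi> u j"
          using staircasesD(3)[OF u, of "Suc i" "Suc j"] i by (auto simp: \<phi>_def)
      qed (simp add: \<phi>_def)
      moreover have "x \<le> \<phi> u 1"
        using staircasesD(3)[OF u, of 1 2] x u1 by (auto simp: \<phi>_def numeral_2_eq_2)
      moreover have "top_count (Suc n) u = top_count n (\<phi> u)"
        using x u1 pos[OF u] by (intro top) (auto simp: \<phi>_def)
      ultimately show "\<phi> u \<in> ?B"
        using y by simp
    qed
    show "\<psi> ` ?B \<subseteq> ?A"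
    proof (rule image_subsetI)
      fix v assume "v \<in> ?B"
      then have v: "v \<in> staircases n" and v1: "x \<le> v 1" and y: "top_count n v = y"
        by auto
      have "\<psi> v \<in> staircases (Suc n)"
      proof (rule staircasesI)
        fix i assume i: "i \<in> {1..Suc n}"
        show "i < \<psi> v i" "\<psi> v i \<le> Suc n + 1"
        proof -
          have "i = 1 \<or> i - 1 \<in> {1..n}"
            using i by auto
          then have "i = 1 \<or> i - 1 < v (i - 1) \<and> v (i - 1) \<le> n + 1"
            using staircasesD(1,2)[OF v] by blast
          then show "i < \<psi> v i" "\<psi> v i \<le> Suc n + 1"
            using i x by (auto simp: \<psi>_def)
        qed
        fix j assume j: "j \<in> {1..Suc n}" "i \<le> j"
        show "\<psi> v i \<le> \<psi> v j"
        proof (cases "i = 1")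
          case True
          have "v 1 \<le> v (j - 1)" if "j \<noteq> 1"
            using that j by (intro staircasesD(3)[OF v]) auto
          then show ?thesis
            using True v1 j by (auto simp: \<psi>_def)
        next
          case False
          then have "v (i - 1) \<le> v (j - 1)"
            using i j by (intro staircasesD(3)[OF v]) auto
          then show ?thesis
            using False i j by (auto simp: \<psi>_def)
        qed
      qed (simp add: \<psi>_def)
      moreover have "top_count (Suc n) (\<psi> v) = top_count n v"
        using x by (intro top) (auto simp: \<psi>_def)
      ultimately show "\<psi> v \<in> ?A"
        using y by (simp add: \<psi>_def)
    qed
  qed
  then have "refined_count (Suc n) x y = card ?B"
    unfolding refined_count_def by (rule bij_betw_same_card)
  \<comment> \<open>The statistic of v is \<open>v 1 - 1\<close>, which explains the lower summation
    bound x - 1 in \<open>tau\<close>. For x = 1 the term s = 0 counts nothing, since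
    \<open>v 1 > 1\<close>.\<close>
  also have "?B = {v \<in> {v \<in> staircases n. top_count n v = y}. v 1 - 1 \<in> {x - 1..n}}"
  proof -
    have "x \<le> v 1 \<longleftrightarrow> v 1 - 1 \<in> {x - 1..n}" if "v \<in> staircases n" for v
      using staircasesD(1,2)[OF that, of 1] x by auto
    then show ?thesis by blast
  qed
  also have "card \<dots> = (\<Sum>s=x-1..n. card {v \<in> {v \<in> staircases n. top_count n v = y}. v 1 - 1 = s})"
    by (rule card_fibres) (auto simp: finite_staircases)
  also have "\<dots> = (\<Sum>s=x-1..n. refined_count n s y)"
  proof (intro sum.cong refl)
    fix s
    have "v 1 - 1 = s \<longleftrightarrow> v 1 = s + 1" if "v \<in> staircases n" for v
      using staircasesD(1)[OF that, of 1] x by auto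
    then have "{v \<in> {v \<in> staircases n. top_count n v = y}. v 1 - 1 = s}
        = {u \<in> staircases n. u 1 = s + 1 \<and> top_count n u = y}"
      by blast
    then show "card {v \<in> {v \<in> staircases n. top_count n v = y}. v 1 - 1 = s} = refined_count n s y"
      by (simp only: refined_count_def)
  qed
  finally show ?thesis .
qed

text \<open>The block \<open>tau\<close> counts the staircases whose first entry is not maximal, and
  the corner entry 1 is the constant staircase.\<close>

lemma C_matrix_eq: "C_matrix (Suc n) x y = int (refined_count (Suc n) x y)"
proof (induction n arbitrary: x y)
  case 0
  show ?case
  proof (cases "x = 1 \<and> y = 1")
    case True
    then show ?thesis
      using refined_count_top[of 1] by (simp add: one_matrix_def)
  next
    case False
    then show ?thesis
      using refined_count_eq_0[of 1 x y] by (auto simp: one_matrix_def)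
  qed
next
  case (Suc n)
  let ?m = "Suc n"
  consider "x \<in> {1..?m}" "y \<in> {1..?m}" | "x = Suc ?m" "y = Suc ?m"
    | "\<not> (x \<in> {1..Suc ?m} \<and> y \<in> {1..Suc ?m}) \<or> (x = Suc ?m) \<noteq> (y = Suc ?m)"
    by fastforce
  then show ?case
  proof cases
    case 1
    then have "C_matrix (Suc ?m) x y = (\<Sum>s=x-1..?m. int (refined_count ?m s y))"
      by (simp add: block_sum_def tau_def Suc)
    then show ?thesis
      using refined_count_Suc[of x ?m y] 1 by simp
  next
    case 2
    then show ?thesis
      using refined_count_top[of "Suc ?m"] by (simp add: block_sum_def one_matrix_def)
  next
    case 3
    then have "C_matrix (Suc ?m) x y = 0"
      by (auto simp: block_sum_def tau_def one_matrix_def)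
    then show ?thesis
      using refined_count_eq_0[of "Suc ?m" x y] 3 by simp
  qed
qed

text \<open>If (i,j) and (k,m) are the statistics of u and w, the summation range of
  \<open>omega\<close> says i + k \<ge> n and j + m \<ge> n; the first becomes n + 2 \<le>
  \<open>u 1 + w 1\<close> because i = \<open>u 1 - 1\<close> and k =
  \<open>w 1 - 1\<close>.\<close>

lemma b_number_eq:
  assumes n: "n \<ge> 1"
  shows "b_number n = int (card {(u, w). u \<in> staircases n \<and> w \<in> staircases n \<and>
    n + 2 \<le> u 1 + w 1 \<and> n \<le> top_count n u + top_count n w})"
proof -
  let ?S = "staircases n"
  have C: "C_matrix n x y = int (refined_count n x y)" for x y
    using n C_matrix_eq[of "n - 1" x y] by simp
  have fibre: "{u \<in> ?S. (u 1 - 1, top_count n u) = (x, y)} = {u \<in> ?S. u 1 = x + 1 \<and> top_count n u = y}" for x y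
  proof -
    have "u 1 - 1 = x \<longleftrightarrow> u 1 = x + 1" if "u \<in> ?S" for u
      using staircasesD(1)[OF that, of 1] n by auto
    then show ?thesis by auto
  qed
  \<comment> \<open>The number of partners w of any u with statistics (i,j); here
    \<open>i + 1\<close> stands for \<open>u 1\<close>.\<close>
  define h where "h i j = card {w \<in> ?S. n + 2 \<le> i + 1 + w 1 \<and> n \<le> j + top_count n w}" for i j
  have omega: "omega n (C_matrix n) i j = int (h i j)" if "i \<in> {1..n}" "j \<in> {1..n}" for i j
  proof -
    have "omega n (C_matrix n) i j = (\<Sum>(k, m)\<in>{n-i..n} \<times> {n-j..n}. int (refined_count n k m))"
      using that by (simp add: omega_def C sum.cartesian_product)
    also have "\<dots> = int (\<Sum>t\<in>{n-i..n} \<times> {n-j..n}. card {w \<in> ?S. (w 1 - 1, top_count n w) = t})"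
      unfolding of_nat_sum
    proof (intro sum.cong refl)
      fix t assume "t \<in> {n-i..n} \<times> {n-j..n}"
      obtain k m where t: "t = (k, m)"
        by fastforce
      show "(case t of (k, m) \<Rightarrow> int (refined_count n k m)) = int (card {w \<in> ?S. (w 1 - 1, top_count n w) = t})"
        unfolding t fibre by (simp add: refined_count_def)
    qed
    also have "\<dots> = int (card {w \<in> ?S. (w 1 - 1, top_count n w) \<in> {n-i..n} \<times> {n-j..n}})"
      by (subst card_fibres) (auto simp: finite_staircases)
    also have "{w \<in> ?S. (w 1 - 1, top_count n w) \<in> {n-i..n} \<times> {n-j..n}}
        = {w \<in> ?S. n + 2 \<le> i + 1 + w 1 \<and> n \<le> j + top_count n w}"
    proof -
      have "(w 1 - 1, top_count n w) \<in> {n-i..n} \<times> {n-j..n} \<longleftrightarrow> n + 2 \<le> i + 1 + w 1 \<and> n \<le> j + top_count n w"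
        if "w \<in> ?S" for w
        using staircasesD(1,2)[OF that, of 1] top_count_le[of n w] n by auto
      then show ?thesis by blast
    qed
    finally show ?thesis
      by (simp add: h_def)
  qed
  have "b_number n = (\<Sum>(i, j)\<in>{1..n} \<times> {1..n}. int (refined_count n i j * h i j))"
    by (simp add: b_number_def mdot_def C omega sum.cartesian_product)
  also have "\<dots> = int (\<Sum>t\<in>{1..n} \<times> {1..n}. \<Sum>u\<in>{u \<in> ?S. (u 1 - 1, top_count n u) = t}.
      h (u 1 - 1) (top_count n u))"
    unfolding of_nat_sum
  proof (intro sum.cong refl)
    fix t assume "t \<in> {1..n} \<times> {1..n}"
    obtain i j where t: "t = (i, j)"
      by fastforce
    have "(\<Sum>u\<in>{u \<in> ?S. (u 1 - 1, top_count n u) = (i, j)}. int (h (u 1 - 1) (top_count n u)))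
        = (\<Sum>u\<in>{u \<in> ?S. (u 1 - 1, top_count n u) = (i, j)}. int (h i j))"
      by (rule sum.cong) auto
    then show "(case t of (i, j) \<Rightarrow> int (refined_count n i j * h i j))
        = (\<Sum>u\<in>{u \<in> ?S. (u 1 - 1, top_count n u) = t}. int (h (u 1 - 1) (top_count n u)))"
      unfolding t fibre by (simp add: refined_count_def)
  qed
  also have "\<dots> = int (\<Sum>u\<in>?S. h (u 1 - 1) (top_count n u))"
  proof -
    have "(u 1 - 1, top_count n u) \<in> {1..n} \<times> {1..n}" if u: "u \<in> ?S" for u
      using staircasesD(1,2)[OF u, of 1] top_count_le[of n u] top_count_ge_1[OF u n] n by auto
    then show ?thesis
      by (subst sum.group) (auto simp: finite_staircases)
  qed
  also have "(\<Sum>u\<in>?S. h (u 1 - 1) (top_count n u))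
      = card (SIGMA u:?S. {w \<in> ?S. n + 2 \<le> u 1 + w 1 \<and> n \<le> top_count n u + top_count n w})"
  proof -
    have "h (u 1 - 1) (top_count n u) = card {w \<in> ?S. n + 2 \<le> u 1 + w 1 \<and> n \<le> top_count n u + top_count n w}"
      if "u \<in> ?S" for u
      using staircasesD(1)[OF that, of 1] n by (simp add: h_def)
    then show ?thesis
      by (simp add: card_SigmaI finite_staircases)
  qed
  also have "(SIGMA u:?S. {w \<in> ?S. n + 2 \<le> u 1 + w 1 \<and> n \<le> top_count n u + top_count n w})
      = {(u, w). u \<in> ?S \<and> w \<in> ?S \<and> n + 2 \<le> u 1 + w 1 \<and> n \<le> top_count n u + top_count n w}"
    by auto
  finally show ?thesis .
qed

text \<open>
  A profile splits into the part with values at most \<open>n\<close>, which is governed by the upper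
  triangular matrices, and the part with larger values, governed by the lower triangular ones.
\<close>

definition lower_part :: "nat \<Rightarrow> (nat \<Rightarrow> nat) \<Rightarrow> nat \<Rightarrow> nat" where
  "lower_part n g = (\<lambda>p\<in>{1..n}. min (g p) (n + 1))"

text \<open>Rotating by p \<mapsto> n + 1 - p and q \<mapsto> 2 n + 2 - q turns the large values
  into a staircase: g i \<le> i + n becomes p < w p, and the cut value n + 1 is fixed.\<close>

definition upper_part :: "nat \<Rightarrow> (nat \<Rightarrow> nat) \<Rightarrow> nat \<Rightarrow> nat" where
  "upper_part n g = (\<lambda>p\<in>{1..n}. 2 * n + 2 - max (g (n + 1 - p)) (n + 1))"

text \<open>This is g = min(g, n + 1) + max(g, n + 1) - (n + 1), with the maximum recovered as 2 n +
  2 - w(n + 1 - p).\<close>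

definition merge :: "nat \<Rightarrow> (nat \<Rightarrow> nat) \<Rightarrow> (nat \<Rightarrow> nat) \<Rightarrow> nat \<Rightarrow> nat" where
  "merge n u w = (\<lambda>p\<in>{1..n}. u p + n + 1 - w (n + 1 - p))"

lemma lower_part_staircase:
  assumes g: "g \<in> profiles n"
  shows "lower_part n g \<in> staircases n"
proof (rule staircasesI)
  fix i assume i: "i \<in> {1..n}"
  show "i < lower_part n g i" "lower_part n g i \<le> n + 1"
    using profilesD(1)[OF g i] i by (auto simp: lower_part_def)
  fix j assume "j \<in> {1..n}" "i \<le> j"
  then show "lower_part n g i \<le> lower_part n g j"
    using profilesD(3)[OF g i, of j] i by (auto simp: lower_part_def)
qed (simp add: lower_part_def)

lemma upper_part_staircase:
  assumes g: "g \<in> profiles n"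
  shows "upper_part n g \<in> staircases n"
proof (rule staircasesI)
  fix i assume i: "i \<in> {1..n}"
  show "i < upper_part n g i" "upper_part n g i \<le> n + 1"
    using profilesD(2)[OF g reflect(1)[OF i]] i by (auto simp: upper_part_def)
  fix j assume j: "j \<in> {1..n}" "i \<le> j"
  have "g (n + 1 - j) \<le> g (n + 1 - i)"
    using profilesD(3)[OF g reflect(1)[OF j(1)] reflect(1)[OF i]] j(2) by (simp add: diff_le_mono2)
  then have "max (g (n + 1 - j)) (n + 1) \<le> max (g (n + 1 - i)) (n + 1)"
    by (rule max.mono) simp
  then show "upper_part n g i \<le> upper_part n g j"
    using i j by (simp add: upper_part_def diff_le_mono2)
qed (simp add: upper_part_def)

text \<open>Since g 1 \<le> n + 1 < g n + 2, the two values are g 1 and 2 n + 2 - g n, so the wrap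
  condition on g is what is expressed here.\<close>

lemma parts_first:
  assumes g: "g \<in> profiles n" and n: "n \<ge> 1"
  shows "n + 2 \<le> lower_part n g 1 + upper_part n g 1"
proof -
  have "1 < g 1" "g 1 \<le> 1 + n" "g n \<le> g 1 + n"
    using profilesD(1,2)[OF g, of 1] profilesD(4)[OF g] n by auto
  then show ?thesis
    using n by (simp add: lower_part_def upper_part_def del: One_nat_def)
qed

text \<open>At each position g is at least n + 1 or at most n + 1, so the maximal entries of the two
  parts, one of them reflected, cover all positions.\<close>

lemma parts_top_count: "n \<le> top_count n (lower_part n g) + top_count n (upper_part n g)"
proof -
  let ?A = "{i \<in> {1..n}. lower_part n g i = n + 1}" and ?B = "{i \<in> {1..n}. upper_part n g i = n + 1}"
  have "{1..n} \<subseteq> ?A \<union> (\<lambda>i. n + 1 - i) ` ?B"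
  proof
    fix i assume i: "i \<in> {1..n}"
    show "i \<in> ?A \<union> (\<lambda>i. n + 1 - i) ` ?B"
    proof (cases "n + 1 \<le> g i")
      case True
      then show ?thesis
        using i by (simp add: lower_part_def)
    next
      case False
      then have "n + 1 - i \<in> ?B" "i = n + 1 - (n + 1 - i)"
        using i by (auto simp: upper_part_def)
      then show ?thesis
        by blast
    qed
  qed
  then have "card {1..n} \<le> card (?A \<union> (\<lambda>i. n + 1 - i) ` ?B)"
    by (intro card_mono) auto
  also have "\<dots> \<le> card ?A + card ((\<lambda>i. n + 1 - i) ` ?B)"
    by (rule card_Un_le)
  also have "\<dots> \<le> card ?A + card ?B"
    by (simp add: card_image_le)
  finally show ?thesis
    by (simp add: top_count_def)
qed

lemma merge_parts:
  assumes g: "g \<in> profiles n"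
  shows "merge n (lower_part n g) (upper_part n g) = g"
proof (rule extensionalityI)
  fix i assume i: "i \<in> {1..n}"
  then have "n + 1 - (n + 1 - i) = i" "n + 1 - i \<in> {1..n}"
    by auto
  then show "merge n (lower_part n g) (upper_part n g) i = g i"
    using profilesD(2)[OF g i] i by (simp add: merge_def lower_part_def upper_part_def)
qed (use g in \<open>auto simp: merge_def profiles_def\<close>)

text \<open>The maximal entries of u form a final segment and the reflected ones of w an initial
  segment, so n of them in total leave no gap. Hence \<open>merge\<close> changes at most one part
  per position and can be undone.\<close>

lemma compatible_cases:
  assumes u: "u \<in> staircases n" and w: "w \<in> staircases n" and top: "n \<le> top_count n u + top_count n w"
    and p: "p \<in> {1..n}"
  shows "u p = n + 1 \<or> w (n + 1 - p) = n + 1"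
proof (rule ccontr)
  assume "\<not> ?thesis"
  then have "top_count n u + p \<le> n" "top_count n w + (n + 1 - p) \<le> n"
    using top_count_less[OF u p] top_count_less[OF w reflect(1)[OF p]] by blast+
  then show False
    using top p by auto
qed

lemma merge_profile:
  assumes u: "u \<in> staircases n" and w: "w \<in> staircases n" and n: "n \<ge> 1"
    and first: "n + 2 \<le> u 1 + w 1" and top: "n \<le> top_count n u + top_count n w"
  shows "merge n u w \<in> profiles n"
proof -
  have wr: "n + 1 - p < w (n + 1 - p)" "w (n + 1 - p) \<le> n + 1" if "p \<in> {1..n}" for p
    using staircasesD(1,2)[OF w reflect(1)[OF that]] by blast+
  have "p < merge n u w p \<and> merge n u w p \<le> p + n" if p: "p \<in> {1..n}" for p
    using staircasesD(1,2)[OF u p] wr[OF p] p by (simp add: merge_def) linarith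
  moreover have "merge n u w p \<le> merge n u w q" if "p \<in> {1..n}" "q \<in> {1..n}" "p \<le> q" for p q
  proof -
    have "w (n + 1 - q) \<le> w (n + 1 - p)"
      using staircasesD(3)[OF w reflect(1)[OF that(2)] reflect(1)[OF that(1)]] that(3)
      by (simp add: diff_le_mono2)
    then show ?thesis
      using staircasesD(3)[OF u that] wr(2)[OF that(1)] wr(2)[OF that(2)] that
      unfolding merge_def restrict_apply by simp
  qed
  \<comment> \<open>As u and w both end in n + 1, the values of \<open>merge\<close> at n and 1 are
    2 n + 2 - w 1 and u 1.\<close>
  moreover have "merge n u w n \<le> merge n u w 1 + n"
    using first staircase_last[OF u n] staircase_last[OF w n] n by (simp add: merge_def)
  ultimately show ?thesis
    by (simp add: profiles_def mono_on_def merge_def)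
qed

lemma parts_merge:
  assumes u: "u \<in> staircases n" and w: "w \<in> staircases n" and top: "n \<le> top_count n u + top_count n w"
  shows "lower_part n (merge n u w) = u" "upper_part n (merge n u w) = w"
proof -
  have bounds: "u p \<le> n + 1" "w p \<le> n + 1" if "p \<in> {1..n}" for p
    using staircasesD(2)[OF u that] staircasesD(2)[OF w that] by auto
  show "lower_part n (merge n u w) = u"
  proof (rule extensionalityI)
    fix p assume p: "p \<in> {1..n}"
    show "lower_part n (merge n u w) p = u p"
      using compatible_cases[OF u w top p] bounds[OF p] bounds[OF reflect(1)[OF p]] p
      by (auto simp: lower_part_def merge_def)
  qed (use staircasesD(4)[OF u] in \<open>auto simp: lower_part_def\<close>)
  show "upper_part n (merge n u w) = w"
  proof (rule extensionalityI)
    fix p assume p: "p \<in> {1..n}"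
    show "upper_part n (merge n u w) p = w p"
      using compatible_cases[OF u w top reflect(1)[OF p]] bounds[OF p] bounds[OF reflect(1)[OF p]] p
      unfolding reflect(2)[OF p] by (auto simp: upper_part_def merge_def)
  qed (use staircasesD(4)[OF w] in \<open>auto simp: upper_part_def\<close>)
qed

lemma card_profiles:
  assumes n: "n \<ge> 1"
  shows "int (card (profiles n)) = b_number n"
proof -
  let ?P = "{(u, w). u \<in> staircases n \<and> w \<in> staircases n \<and>
    n + 2 \<le> u 1 + w 1 \<and> n \<le> top_count n u + top_count n w}"
  have "bij_betw (\<lambda>g. (lower_part n g, upper_part n g)) (profiles n) ?P"
  proof (rule bij_betw_byWitness[where f' = "\<lambda>(u, w). merge n u w"])
    show "(\<lambda>g. (lower_part n g, upper_part n g)) ` profiles n \<subseteq> ?P"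
      using lower_part_staircase upper_part_staircase parts_first[OF _ n] parts_top_count by blast
    show "(\<lambda>(u, w). merge n u w) ` ?P \<subseteq> profiles n"
      using merge_profile[OF _ _ n] by auto
  qed (auto simp: merge_parts parts_merge)
  then show ?thesis
    unfolding b_number_eq[OF n] by (simp only: bij_betw_same_card)
qed

theorem theorem1:
  fixes n :: nat
  assumes "n \<ge> 2"
  shows "finite (combinatorial_ideals n // ideal_equiv n) \<and>
         int (card (combinatorial_ideals n // ideal_equiv n)) = b_number n"
proof
  show "finite (combinatorial_ideals n // ideal_equiv n)"
    using bij_betw_finite[OF bij_betw_profiles[OF assms]] finite_profiles by simp
  show "int (card (combinatorial_ideals n // ideal_equiv n)) = b_number n"
    using bij_betw_same_card[OF bij_betw_profiles[OF assms]] card_profiles[of n] assms by simp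
qed

end
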